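(* Let $\gamma>-1$, $1<p<\infty$ and $\frac1p+\frac1q=1$. Let $f\in L_a^p(\mathbb{D},dA_\gamma)$ and $f^{-1}\in L_a^q(\mathbb{D},dA_\gamma)$ satisfy $$\sup_{z\in\mathbb{D}}\left\{B_\gamma\left(\left|fk_z^{1-2/p}\right|^p\right)(z)\right\}^{\frac1p}\left\{B_\gamma\left(\left|f^{-1}k_z^{1-2/q}\right|^q\right)(z)\right\}^{\frac1q}<\infty.$$ Then there exists $\epsilon>0$ such that $$\sup_{z\in\mathbb{D}}\left\{B_\gamma\left(\left|fk_z^{1-2/p}\right|^{p+\epsilon}\right)(z)\right\}^{\frac{1}{p+\epsilon}}\left\{B_\gamma\left(\left|f^{-1}k_z^{1-2/q}\right|^{q+\epsilon}\right)(z)\right\}^{\frac{1}{q+\epsilon}}<\infty.$$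
   Context: $\mathbb{D}$ is the open unit disk and $dA_\gamma(z)=c_\gamma(1-|z|^2)^\gamma dA(z)$, where $dA$ is area measure and $c_\gamma$ makes $A_\gamma$ a probability measure. $L_a^p(\mathbb{D},dA_\gamma)$ is the space of analytic functions on $\mathbb{D}$ belonging to $L^p(\mathbb{D},dA_\gamma)$; $f^{-1}$ denotes $1/f$ (so the hypothesis $f^{-1}\in L_a^q$ includes that $f$ has no zeros). The normalized Bergman kernel is $k_z(u)=\frac{(1-|z|^2)^{(2+\gamma)/2}}{(1-u\overline z)^{2+\gamma}}$, and the Berezin transform is $B_\gamma(h)(z)=\int_{\mathbb{D}}h(u)|k_z(u)|^2\,dA_\gamma(u)$. *)

theory Defs
  imports "HOL-Complex_Analysis.Complex_Analysis"
begin

abbreviation unit_disk :: "complex set" (\<open>\<bbbD>\<close>)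
  where "\<bbbD> \<equiv> ball 0 1"

text \<open>The normalising constant \<open>c\<^sub>\<gamma>\<close>: the reciprocal of the total mass of
  \<open>(1 - |z|\<^sup>2)\<^sup>\<gamma> dA(z)\<close>, where the area measure is Lebesgue measure on the plane.
  The total mass is finite exactly for \<open>\<gamma> > -1\<close>.\<close>

definition weight_const :: "real \<Rightarrow> real" where
  "weight_const \<gamma> =
     1 / (LINT z|restrict_space lborel \<bbbD>. (1 - (cmod z)\<^sup>2) powr \<gamma>)"

definition disk_measure :: "real \<Rightarrow> complex measure" where
  "disk_measure \<gamma> = density (restrict_space lborel \<bbbD>)
     (\<lambda>z. ennreal (weight_const \<gamma> * (1 - (cmod z)\<^sup>2) powr \<gamma>))"

definition bergman_space :: "real \<Rightarrow> real \<Rightarrow> (complex \<Rightarrow> complex) set" where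
  "bergman_space p \<gamma> =
     {f. f holomorphic_on \<bbbD> \<and> integrable (disk_measure \<gamma>) (\<lambda>z. cmod (f z) powr p)}"

definition bergman_kernel :: "real \<Rightarrow> complex \<Rightarrow> complex \<Rightarrow> complex" where
  "bergman_kernel \<gamma> z u =
     complex_of_real ((1 - (cmod z)\<^sup>2) powr ((2 + \<gamma>) / 2)) /
       (1 - u * cnj z) powr complex_of_real (2 + \<gamma>)"

text \<open>The Berezin transform is only applied to nonnegative functions here. It takes values in
  \<^typ>\<open>ennreal\<close>, so that a divergent integral has the value \<open>\<infinity>\<close> and not \<open>0\<close>, as it would
  with the Bochner integral.\<close>

definition berezin :: "real \<Rightarrow> (complex \<Rightarrow> ennreal) \<Rightarrow> complex \<Rightarrow> ennreal" where
  "berezin \<gamma> h z =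
     (\<integral>\<^sup>+u. h u * ennreal ((cmod (bergman_kernel \<gamma> z u))\<^sup>2) \<partial>disk_measure \<gamma>)"

text \<open>Real powers on \<open>[0, \<infinity>]\<close>, meant for positive exponents only.\<close>

definition ennpowr :: "ennreal \<Rightarrow> real \<Rightarrow> ennreal" where
  "ennpowr x a = (if x = \<infinity> then \<infinity> else ennreal (enn2real x powr a))"

text \<open>The quantity \<open>B\<^sub>\<gamma>(|f k\<^sub>z\<^bsup>1-2/p\<^esup>|\<^sup>r)(z)\<^bsup>1/r\<^esup>\<close>. The power of the kernel is the
  principal one; since the exponent \<open>1 - 2/p\<close> is real, its modulus does not depend on the
  choice of the branch.\<close>

definition berezin_mean ::
  "real \<Rightarrow> real \<Rightarrow> real \<Rightarrow> (complex \<Rightarrow> complex) \<Rightarrow> complex \<Rightarrow> ennreal" where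
  "berezin_mean \<gamma> p r f z =
     ennpowr
       (berezin \<gamma>
         (\<lambda>u. ennreal (cmod (f u * bergman_kernel \<gamma> z u powr complex_of_real (1 - 2 / p)) powr r)) z)
       (1 / r)"

end

theory Submission
  imports Defs
begin

text \<open>
  Let \<open>W(z)\<close> and \<open>V(z)\<close> be the integrals of \<open>|f k\<^sub>z|\<^sup>p\<close> and \<open>|k\<^sub>z / f|\<^sup>q\<close>. The mean value property, applied
  to a branch of the \<open>q\<close>-th power of the zero-free function \<open>k\<^sub>z / f\<close> at \<open>z\<close>, bounds \<open>V(z)\<close> from below,
  so the hypothesis becomes an \<open>A\<^sub>1\<close>-type bound of \<open>W(z)\<close> by a multiple of \<open>|f(z)|\<^sup>p\<close> times
  \<open>1 - |z|\<^sup>2\<close> to the power \<open>(2 + \<gamma>)(1 - p/2)\<close>. After multiplication by \<open>|k\<^sub>a(z)|\<^sup>p\<close> it says that \<open>w = |f k\<^sub>a|\<^sup>p\<close> dominates its own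
  averages. Let \<open>h(u) = 1 - |\<phi>\<^sub>a(u)|\<^sup>2\<close> for the Moebius involution \<open>\<phi>\<^sub>a\<close>. Above every \<open>u\<close> with \<open>h(u) < \<rho>\<close>
  there is a hyperbolic ball inside the ring \<open>\<rho>/2 \<le> h < \<rho>\<close> on which the averaging kernel has mass
  bounded below; by Fubini the ring carries a fixed proportion of the \<open>w\<close>-mass of \<open>{h < \<rho>}\<close>. Hence that
  mass decays like a power of \<open>\<rho>\<close>, and \<open>w h\<^bsup>-\<eta>\<^esup>\<close> has integral at most \<open>C W(a)\<close> for small \<open>\<eta>\<close>, uniformly in
  \<open>a\<close>. The pointwise bound of \<open>|f k\<^sub>a|\<^sup>\<epsilon>\<close> by the mean value property turns this into the reverse Hoelder
  inequality for \<open>f\<close>, and the same argument applies to \<open>1/f\<close>. Every step is conformally invariant, but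
  written in terms of \<open>k\<^sub>a\<close> it needs no change of variables.
\<close>

subsection \<open>Rotation invariance and the area mean value inequality\<close>

text \<open>Both measures give a box the product of its side lengths, and this determines Lebesgue
  measure. It makes Tonelli in real coordinates available on the plane.\<close>

lemma lborel_complex_eq_distr:
  "(lborel :: complex measure) = distr (lborel \<Otimes>\<^sub>M lborel) borel (\<lambda>(x, y). Complex x y)"
proof (rule lborel_eqI)
  fix l u :: complex
  assume lu: "\<And>b. b \<in> Basis \<Longrightarrow> l \<bullet> b \<le> u \<bullet> b"
  have le: "Re l \<le> Re u" "Im l \<le> Im u"
    using lu[of 1] lu[of \<i>] by (auto simp: Basis_complex_def)
  have [measurable]: "(\<lambda>(x, y). Complex x y) \<in> lborel \<Otimes>\<^sub>M lborel \<rightarrow>\<^sub>M borel"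
    unfolding Complex_eq by measurable
  have "(\<lambda>(x, y). Complex x y) -` box l u = {Re l<..<Re u} \<times> {Im l<..<Im u}"
    by (auto simp: box_def Basis_complex_def)
  then have "emeasure (distr (lborel \<Otimes>\<^sub>M lborel) borel (\<lambda>(x, y). Complex x y)) (box l u)
      = emeasure (lborel \<Otimes>\<^sub>M lborel) ({Re l<..<Re u} \<times> {Im l<..<Im u})"
    by (subst emeasure_distr) (auto simp: space_pair_measure)
  also have "\<dots> = ennreal ((Re u - Re l) * (Im u - Im l))"
    using le by (subst lborel.emeasure_pair_measure_Times) (auto simp: ennreal_mult)
  also have "\<dots> = ennreal (\<Prod>b\<in>Basis. (u - l) \<bullet> b)"
    by (simp add: Basis_complex_def)
  finally show "emeasure (distr (lborel \<Otimes>\<^sub>M lborel) borel (\<lambda>(x, y). Complex x y)) (box l u)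
    = (\<Prod>b\<in>Basis. (u - l) \<bullet> b)" .
qed simp

lemma nn_integral_complex:
  assumes [measurable]: "f \<in> borel_measurable borel"
  shows "(\<integral>\<^sup>+z. f z \<partial>lborel) = (\<integral>\<^sup>+y. \<integral>\<^sup>+x. f (Complex x y) \<partial>lborel \<partial>lborel)"
    and "(\<integral>\<^sup>+z. f z \<partial>lborel) = (\<integral>\<^sup>+x. \<integral>\<^sup>+y. f (Complex x y) \<partial>lborel \<partial>lborel)"
proof -
  have [measurable]: "(\<lambda>(x, y). Complex x y) \<in> lborel \<Otimes>\<^sub>M lborel \<rightarrow>\<^sub>M borel"
    unfolding Complex_eq by measurable
  have "(\<integral>\<^sup>+z. f z \<partial>lborel) = (\<integral>\<^sup>+p. (case p of (x, y) \<Rightarrow> f (Complex x y)) \<partial>(lborel \<Otimes>\<^sub>M lborel))"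
    by (subst lborel_complex_eq_distr) (simp add: nn_integral_distr case_prod_unfold)
  then show "(\<integral>\<^sup>+z. f z \<partial>lborel) = (\<integral>\<^sup>+y. \<integral>\<^sup>+x. f (Complex x y) \<partial>lborel \<partial>lborel)"
    and "(\<integral>\<^sup>+z. f z \<partial>lborel) = (\<integral>\<^sup>+x. \<integral>\<^sup>+y. f (Complex x y) \<partial>lborel \<partial>lborel)"
    using lborel_pair.nn_integral_snd[of "\<lambda>p. f (Complex (fst p) (snd p))"]
      lborel.nn_integral_fst[of "\<lambda>p. f (Complex (fst p) (snd p))" lborel]
    by (simp_all add: case_prod_unfold Complex_eq)
qed

text \<open>With Tonelli, a rotation becomes two one-dimensional affine substitutions: the real part
  of the image replaces x, the order of integration is exchanged, and the imaginary part replaces y.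
  The Jacobian factors \<open>\<bar>c\<bar>\<close> and \<open>\<bar>1 / c\<bar>\<close>
  cancel.\<close>

lemma nn_integral_complex_rotate:
  assumes [measurable]: "f \<in> borel_measurable borel" and w: "cmod w = 1"
  shows "(\<integral>\<^sup>+z. f (w * z) \<partial>lborel) = (\<integral>\<^sup>+z. f z \<partial>lborel)"
proof -
  define c s where "c = Re w" and "s = Im w"
  have cs: "c\<^sup>2 + s\<^sup>2 = 1"
    using w by (simp add: c_def s_def cmod_power2[symmetric])
  have wz: "w * Complex x y = Complex (c * x - s * y) (s * x + c * y)" for x y
    by (simp add: complex_eq_iff c_def s_def)
  have [measurable]: "(\<lambda>(x, y). Complex x y) \<in> borel \<Otimes>\<^sub>M borel \<rightarrow>\<^sub>M borel"
    unfolding Complex_eq by measurable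
  have [measurable]: "(\<lambda>x. f (Complex (u x) (v x))) \<in> borel_measurable borel"
    if [measurable]: "u \<in> borel_measurable borel" "v \<in> borel_measurable borel" for u v :: "real \<Rightarrow> real"
    unfolding Complex_eq by measurable
  show ?thesis
  \<comment> \<open>The substitutions divide by \<open>c\<close>. A quarter turn only exchanges the
    coordinates up to sign and is treated separately.\<close>
  proof (cases "c = 0")
    case True
    with cs have s: "\<bar>s\<bar> = 1" by (auto simp: power2_eq_1_iff)
    then have s0: "s \<noteq> 0" "- s \<noteq> 0" by auto
    have "(\<integral>\<^sup>+z. f (w * z) \<partial>lborel) = (\<integral>\<^sup>+y. \<integral>\<^sup>+x. f (Complex (- s * y) (s * x)) \<partial>lborel \<partial>lborel)"
      by (subst nn_integral_complex) (simp_all add: wz True)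
    also have "\<dots> = (\<integral>\<^sup>+y. \<integral>\<^sup>+x. f (Complex (- s * y) x) \<partial>lborel \<partial>lborel)"
      using nn_integral_real_affine[OF _ s0(1), of "\<lambda>x. f (Complex (- s * y) x)" 0 for y] s by simp
    also have "\<dots> = (\<integral>\<^sup>+x. \<integral>\<^sup>+y. f (Complex x y) \<partial>lborel \<partial>lborel)"
      using nn_integral_real_affine[OF _ s0(2), of "\<lambda>x. \<integral>\<^sup>+y. f (Complex x y) \<partial>lborel" 0] s
      by (simp add: Complex_eq)
    also have "\<dots> = (\<integral>\<^sup>+z. f z \<partial>lborel)"
      by (rule nn_integral_complex(2)[symmetric]) simp
    finally show ?thesis .
  next
    case False
    have inv: "ennreal \<bar>c\<bar> * ennreal \<bar>1 / c\<bar> = 1"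
      using False by (simp add: ennreal_mult[symmetric] del: ennreal_1 flip: ennreal_1)
    have "ennreal \<bar>c\<bar> * (\<integral>\<^sup>+z. f (w * z) \<partial>lborel)
        = (\<integral>\<^sup>+y. ennreal \<bar>c\<bar> * (\<integral>\<^sup>+x. f (Complex (c * x - s * y) (s * x + c * y)) \<partial>lborel) \<partial>lborel)"
      by (subst nn_integral_complex, simp, simp only: wz, subst nn_integral_cmult) (simp_all add: Complex_eq)
    also have "\<dots> = (\<integral>\<^sup>+y. \<integral>\<^sup>+x. f (Complex x (s / c * x + 1 / c * y)) \<partial>lborel \<partial>lborel)"
    proof (intro nn_integral_cong)
      fix y
      have "s / c * (c * x - s * y) + 1 / c * y = s * x + c * y" for x
      proof -
        have "y = (c\<^sup>2 + s\<^sup>2) * y" using cs by simp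
        then have "1 / c * y = (c * c + s * s) * y / c" by (simp add: power2_eq_square)
        also have "\<dots> = c * y + s * s * y / c" using False by (simp add: field_simps)
        finally show ?thesis using False by (simp add: field_simps)
      qed
      then show "ennreal \<bar>c\<bar> * (\<integral>\<^sup>+x. f (Complex (c * x - s * y) (s * x + c * y)) \<partial>lborel)
        = (\<integral>\<^sup>+x. f (Complex x (s / c * x + 1 / c * y)) \<partial>lborel)"
        using nn_integral_real_affine[OF _ False, of "\<lambda>x. f (Complex x (s / c * x + 1 / c * y))" "- s * y"]
        by (simp add: algebra_simps)
    qed
    also have "\<dots> = (\<integral>\<^sup>+x. \<integral>\<^sup>+y. f (Complex x (s / c * x + 1 / c * y)) \<partial>lborel \<partial>lborel)"
      by (rule lborel_pair.Fubini') (simp add: Complex_eq case_prod_unfold)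
    also have "\<dots> = (\<integral>\<^sup>+x. ennreal \<bar>c\<bar> * (\<integral>\<^sup>+y. f (Complex x y) \<partial>lborel) \<partial>lborel)"
    proof (intro nn_integral_cong)
      fix x
      have "(\<integral>\<^sup>+y. f (Complex x y) \<partial>lborel)
          = ennreal \<bar>1 / c\<bar> * (\<integral>\<^sup>+y. f (Complex x (s / c * x + 1 / c * y)) \<partial>lborel)"
        using False by (intro nn_integral_real_affine) simp_all
      then show "(\<integral>\<^sup>+y. f (Complex x (s / c * x + 1 / c * y)) \<partial>lborel)
          = ennreal \<bar>c\<bar> * (\<integral>\<^sup>+y. f (Complex x y) \<partial>lborel)"
        by (simp add: mult.assoc[symmetric] inv del: abs_divide)
    qed
    also have "\<dots> = ennreal \<bar>c\<bar> * (\<integral>\<^sup>+z. f z \<partial>lborel)"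
      by (subst nn_integral_complex(2)) (simp_all add: nn_integral_cmult Complex_eq)
    finally show ?thesis
      using False by (simp add: ennreal_mult_cancel_left)
  qed
qed

text \<open>Cauchy's integral formula at the centre, followed by the triangle inequality. The bound
  is a nonnegative integral, so that the angle can be exchanged with an area integral without any
  integrability condition.\<close>

lemma holomorphic_circle_mean_le:
  assumes g: "g holomorphic_on cball 0 1"
  shows "ennreal (cmod (g 0)) \<le> (\<integral>\<^sup>+x. ennreal (cmod (g (cis (2 * pi * x)))) * indicator {0..1} x \<partial>lborel)"
proof -
  have "((\<lambda>u. g u / (u - 0)) has_contour_integral (2 * of_real pi * \<i> * g 0)) (circlepath 0 1)"
    by (rule Cauchy_integral_circlepath_simple[OF g]) simp
  then have "((\<lambda>x. g (exp (2 * of_real pi * \<i> * of_real x)) / exp (2 * of_real pi * \<i> * of_real x)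
      * (2 * of_real pi * \<i> * exp (2 * of_real pi * \<i> * of_real x))) has_integral (2 * of_real pi * \<i> * g 0)) {0..1}"
    unfolding has_contour_integral vector_derivative_circlepath by (simp add: circlepath)
  then have "((\<lambda>x. 2 * of_real pi * \<i> * g (cis (2 * pi * x))) has_integral (2 * of_real pi * \<i> * g 0)) {0..1}"
    by (simp add: cis_conv_exp mult_ac)
  from has_integral_mult_right[OF this, of "1 / (2 * of_real pi * \<i>)"]
  have int: "((\<lambda>x. g (cis (2 * pi * x))) has_integral g 0) {0..1}"
    by simp
  have cont: "continuous_on {0..1} (\<lambda>x. g (cis (2 * pi * x)))"
    by (rule continuous_on_compose2[OF holomorphic_on_imp_continuous_on[OF g]])
       (auto intro!: continuous_intros)
  have si: "set_integrable lborel {0..1} (\<lambda>x. g (cis (2 * pi * x)))"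
    by (rule borel_integrable_atLeastAtMost'[OF cont])
  have "(LINT x:{0..1}|lborel. g (cis (2 * pi * x))) = g 0"
    using int set_borel_integral_eq_integral(2)[OF si] by (simp add: integral_unique)
  then have "ennreal (cmod (g 0)) = ennreal (cmod (LINT x|lborel. indicator {0..1} x *\<^sub>R g (cis (2 * pi * x))))"
    by (simp add: set_lebesgue_integral_def)
  also have "\<dots> \<le> (\<integral>\<^sup>+x. ennreal (cmod (indicator {0..1} x *\<^sub>R g (cis (2 * pi * x)))) \<partial>lborel)"
    using si by (intro integral_norm_bound_ennreal) (simp add: set_integrable_def)
  also have "\<dots> = (\<integral>\<^sup>+x. ennreal (cmod (g (cis (2 * pi * x)))) * indicator {0..1} x \<partial>lborel)"
    by (intro nn_integral_cong) (auto simp: indicator_def)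
  finally show ?thesis .
qed

lemma emeasure_ball_complex:
  "0 \<le> r \<Longrightarrow> emeasure lborel (ball (z::complex) r) = ennreal (pi * r\<^sup>2)"
  by (simp add: emeasure_ball unit_ball_vol_2)

text \<open>Averaging the rotated integrals over the angle reduces the area mean to the circle mean without
  polar coordinates.\<close>

lemma holomorphic_area_mean_le:
  assumes G: "G holomorphic_on ball z r" and r: "0 \<le> r"
  shows "ennreal (pi * r\<^sup>2 * cmod (G z)) \<le> (\<integral>\<^sup>+v. ennreal (cmod (G v)) * indicator (ball z r) v \<partial>lborel)"
proof -
  define h where "h v = ennreal (cmod (G (z + v))) * indicator (ball 0 r) v" for v
  have cG: "continuous_on (ball 0 r) (\<lambda>v. G (z + v))"
    by (rule continuous_on_compose2[OF holomorphic_on_imp_continuous_on[OF G]])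
       (auto intro!: continuous_intros simp: dist_norm)
  have h_alt: "h = (\<lambda>v. ennreal (indicator (ball 0 r) v *\<^sub>R cmod (G (z + v))))"
    by (auto simp: h_def indicator_def)
  have [measurable]: "h \<in> borel_measurable borel"
    unfolding h_alt
    by (intro measurable_compose[OF _ measurable_ennreal] borel_measurable_continuous_on_indicator
          continuous_intros cG) auto
  have "ennreal (pi * r\<^sup>2 * cmod (G z)) = (\<integral>\<^sup>+v. ennreal (cmod (G z)) * indicator (ball (0::complex) r) v \<partial>lborel)"
    using r by (simp add: emeasure_ball_complex nn_integral_cmult_indicator ennreal_mult mult.commute)
  also have "\<dots> \<le> (\<integral>\<^sup>+v. \<integral>\<^sup>+x. h (cis (2 * pi * x) * v) * indicator {0..1} x \<partial>lborel \<partial>lborel)"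
  proof (intro nn_integral_mono)
    fix v :: complex
    show "ennreal (cmod (G z)) * indicator (ball 0 r) v \<le> (\<integral>\<^sup>+x. h (cis (2 * pi * x) * v) * indicator {0..1} x \<partial>lborel)"
    proof (cases "v \<in> ball 0 r")
      case True
      \<comment> \<open>The values of \<open>G\<close> on the circle about \<open>z\<close> through
        \<open>z + v\<close> are those of this rescaled function on the unit circle.\<close>
      have "(\<lambda>\<xi>. G (z + \<xi> * v)) holomorphic_on cball 0 1"
      proof (rule holomorphic_on_compose_gen[OF _ G, unfolded o_def])
        show "(\<lambda>\<xi>. z + \<xi> * v) holomorphic_on cball 0 1"
          by (intro holomorphic_intros)
        have "norm (\<xi> * v) < r" if "\<xi> \<in> cball 0 1" for \<xi>
          using that True mult_left_le_one_le[of "norm v" "norm \<xi>"]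
          by (simp add: norm_mult dist_norm)
        then show "(\<lambda>\<xi>. z + \<xi> * v) ` cball 0 1 \<subseteq> ball z r"
          by (auto simp: dist_norm)
      qed
      from holomorphic_circle_mean_le[OF this]
      show ?thesis using True by (simp add: h_def norm_mult)
    qed simp
  qed
  also have "\<dots> = (\<integral>\<^sup>+x. \<integral>\<^sup>+v. h (cis (2 * pi * x) * v) * indicator {0..1} x \<partial>lborel \<partial>lborel)"
    by (rule lborel_pair.Fubini') (simp add: case_prod_unfold cis_conv_exp)
  also have "\<dots> = (\<integral>\<^sup>+x. (\<integral>\<^sup>+v. h v \<partial>lborel) * indicator {0..1} (x::real) \<partial>lborel)"
    by (intro nn_integral_cong) (simp add: nn_integral_multc nn_integral_complex_rotate)
  also have "\<dots> = (\<integral>\<^sup>+v. h v \<partial>lborel)"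
    by (simp add: nn_integral_cmult_indicator)
  also have "\<dots> = (\<integral>\<^sup>+v. h (v - z) \<partial>lborel)"
    using nn_integral_distr[of "(+) (- z)" lborel borel h] lborel_distr_plus[of "- z"] by simp
  also have "\<dots> = (\<integral>\<^sup>+v. ennreal (cmod (G v)) * indicator (ball z r) v \<partial>lborel)"
    by (intro nn_integral_cong) (auto simp: h_def indicator_def dist_norm norm_minus_commute)
  finally show ?thesis .
qed

subsection \<open>Weighted measure and Bergman kernel\<close>

lemma space_disk_measure [simp]: "space (disk_measure \<gamma>) = \<bbbD>"
  by (simp add: disk_measure_def space_restrict_space)

lemma borel_measurable_disk_measureI:
  fixes h :: "complex \<Rightarrow> 'a::topological_space"
  assumes "continuous_on \<bbbD> h"
  shows "h \<in> borel_measurable (disk_measure \<gamma>)"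
proof -
  have "h \<in> borel_measurable (restrict_space borel \<bbbD>)"
    by (rule borel_measurable_continuous_on_restrict[OF assms])
  then show ?thesis
    by (simp add: disk_measure_def cong: measurable_cong_sets sets_restrict_space_cong)
qed

lemma nn_integral_disk_measure:
  assumes "h \<in> borel_measurable (disk_measure \<gamma>)"
  shows "(\<integral>\<^sup>+z. h z \<partial>disk_measure \<gamma>)
    = (\<integral>\<^sup>+z. ennreal (weight_const \<gamma> * (1 - (cmod z)\<^sup>2) powr \<gamma>) * h z * indicator \<bbbD> z \<partial>lborel)"
proof -
  have h: "h \<in> borel_measurable (restrict_space lborel \<bbbD>)"
    using assms by (simp add: disk_measure_def cong: measurable_cong_sets)
  have "(\<lambda>z. ennreal (weight_const \<gamma> * (1 - (cmod z)\<^sup>2) powr \<gamma>)) \<in> borel_measurable (restrict_space lborel \<bbbD>)"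
    by (intro measurable_restrict_space1) measurable
  then show ?thesis
    unfolding disk_measure_def by (simp add: nn_integral_density[OF _ h] nn_integral_restrict_space)
qed

lemma sigma_finite_disk_measure: "sigma_finite_measure (disk_measure \<gamma>)"
proof -
  interpret R: sigma_finite_measure "restrict_space lborel \<bbbD>"
    by (intro sigma_finite_measure_restrict_space lborel.sigma_finite_measure_axioms) simp
  have "(\<lambda>z. ennreal (weight_const \<gamma> * (1 - (cmod z)\<^sup>2) powr \<gamma>)) \<in> borel_measurable (restrict_space lborel \<bbbD>)"
    by (intro measurable_restrict_space1) measurable
  then show ?thesis
    unfolding disk_measure_def by (subst R.sigma_finite_iff_density_finite) auto
qed

lemma weight_const_nonneg: "0 \<le> weight_const \<gamma>"
  by (simp add: weight_const_def integral_nonneg)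

lemma disk_points:
  assumes "a \<in> \<bbbD>" "u \<in> \<bbbD>"
  shows "0 < cmod (1 - u * cnj a)" "0 < Re (1 - u * cnj a)" "0 < 1 - (cmod a)\<^sup>2"
proof -
  have "cmod (u * cnj a) < 1"
    using mult_strict_mono'[of "cmod u" 1 "cmod a" 1] assms by (simp add: norm_mult)
  moreover from this show "0 < Re (1 - u * cnj a)"
    using complex_Re_le_cmod[of "u * cnj a"] by (simp del: times_complex.sel)
  ultimately show "0 < cmod (1 - u * cnj a)" by auto
  show "0 < 1 - (cmod a)\<^sup>2"
    using assms by (simp add: abs_square_less_1)
qed

lemma cmod_bergman_kernel:
  "cmod (bergman_kernel \<gamma> a u)
    = (1 - (cmod a)\<^sup>2) powr ((2 + \<gamma>) / 2) / cmod (1 - u * cnj a) powr (2 + \<gamma>)"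
  by (simp add: bergman_kernel_def norm_divide norm_powr_real_powr')

lemma bergman_kernel_holomorphic_on:
  assumes "a \<in> \<bbbD>"
  shows "bergman_kernel \<gamma> a holomorphic_on \<bbbD>"
proof -
  have "1 - u * cnj a \<notin> \<real>\<^sub>\<le>\<^sub>0" "1 - u * cnj a \<noteq> 0" if "u \<in> \<bbbD>" for u
    using disk_points[OF assms that] by (auto simp: complex_nonpos_Reals_iff)
  then show ?thesis
    unfolding bergman_kernel_def by (intro holomorphic_intros) auto
qed

lemma bergman_kernel_pos:
  assumes "a \<in> \<bbbD>" "u \<in> \<bbbD>"
  shows "0 < cmod (bergman_kernel \<gamma> a u)"
  using disk_points[OF assms] by (simp add: cmod_bergman_kernel)

lemma cmod_one_minus_self:
  assumes "z \<in> \<bbbD>"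
  shows "cmod (1 - z * cnj z) = 1 - (cmod z)\<^sup>2"
proof -
  have "1 - z * cnj z = complex_of_real (1 - (cmod z)\<^sup>2)"
    by (simp add: complex_norm_square[symmetric])
  then show ?thesis
    using disk_points(3)[OF assms assms] by (simp only: norm_of_real)
qed

lemma bergman_kernel_diag:
  assumes "z \<in> \<bbbD>"
  shows "cmod (bergman_kernel \<gamma> z z) = (1 - (cmod z)\<^sup>2) powr (- ((2 + \<gamma>) / 2))"
  using disk_points(3)[OF assms assms]
  by (simp add: cmod_bergman_kernel cmod_one_minus_self[OF assms] powr_diff[symmetric]
      diff_divide_distrib add_divide_distrib)

section \<open>Pointwise control of zero-free functions by their integrals\<close>

lemma powr_comparable:
  fixes x y s :: real
  assumes "0 < x" "0 < y" "x \<le> 4 * y" "y \<le> 4 * x"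
  shows "4 powr - \<bar>s\<bar> * x powr s \<le> y powr s"
proof (cases "0 \<le> s")
  case True
  have "4 powr - \<bar>s\<bar> * x powr s = (x / 4) powr s"
    using assms True by (simp add: powr_divide powr_minus field_simps)
  also have "\<dots> \<le> y powr s"
    using assms True by (intro powr_mono2) auto
  finally show ?thesis .
next
  case False
  have "4 powr - \<bar>s\<bar> * x powr s = (4 * x) powr s"
    using assms False by (simp add: powr_mult)
  also have "\<dots> \<le> y powr s"
    using assms False by (intro powr_mono2') auto
  finally show ?thesis .
qed

text \<open>A zero-free function on the disk has a holomorphic logarithm, so every real power has a
  holomorphic branch.\<close>

lemma holomorphic_powr_modulus:
  assumes "g holomorphic_on \<bbbD>" "\<And>v. v \<in> \<bbbD> \<Longrightarrow> g v \<noteq> 0"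
  obtains G where "G holomorphic_on \<bbbD>" "\<And>v. v \<in> \<bbbD> \<Longrightarrow> cmod (G v) = cmod (g v) powr p"
proof -
  obtain h where h: "h holomorphic_on \<bbbD>" "\<And>v. v \<in> \<bbbD> \<Longrightarrow> exp (h v) = g v"
    using holomorphic_logarithm_exists[of \<bbbD> g 0] assms by auto
  show ?thesis
  proof
    show "(\<lambda>v. exp (of_real p * h v)) holomorphic_on \<bbbD>"
      by (intro holomorphic_intros h)
    show "cmod (exp (of_real p * h v)) = cmod (g v) powr p" if "v \<in> \<bbbD>" for v
    proof -
      have "cmod (g v) = exp (Re (h v))"
        using h(2)[OF that] by (metis norm_exp_eq_Re)
      then show ?thesis by (simp add: powr_def)
    qed
  qed
qed

text \<open>The area mean value inequality is applied to a holomorphic branch of the power of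
  \<open>g\<close>, on a ball where the weight is nearly constant. The constant is chosen before
  \<open>g\<close>, \<open>p\<close> and \<open>z\<close>, so one value serves both exponents and
  every kernel.\<close>

lemma bergman_pointwise_bound:
  assumes c: "0 < weight_const \<gamma>"
  obtains C where "0 < C"
    and "\<And>g p z. g holomorphic_on \<bbbD> \<Longrightarrow> (\<And>v. v \<in> \<bbbD> \<Longrightarrow> g v \<noteq> 0) \<Longrightarrow> z \<in> \<bbbD> \<Longrightarrow>
      ennreal (cmod (g z) powr p)
        \<le> ennreal (C * (1 - (cmod z)\<^sup>2) powr - (2 + \<gamma>)) * (\<integral>\<^sup>+v. ennreal (cmod (g v) powr p) \<partial>disk_measure \<gamma>)"
proof
  define c where "c = weight_const \<gamma>"
  \<comment> \<open>Lower bounds for weight and area: the weight on the ball is at least c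
    X^\<gamma> up to the factor \<open>4 powr - \<bar>\<gamma>\<bar>\<close>, and the area is at
    least pi (X/4)^2, where X = 1 - |z|^2.\<close>
  define m where "m = c * 4 powr - \<bar>\<gamma>\<bar> * pi / 16"
  have m: "0 < m" using c by (simp add: m_def c_def)
  show "0 < 1 / m" using m by simp
  fix g :: "complex \<Rightarrow> complex" and p :: real and z :: complex
  assume g: "g holomorphic_on \<bbbD>" "\<And>v. v \<in> \<bbbD> \<Longrightarrow> g v \<noteq> 0" and z: "z \<in> \<bbbD>"
  obtain G where G: "G holomorphic_on \<bbbD>" "\<And>v. v \<in> \<bbbD> \<Longrightarrow> cmod (G v) = cmod (g v) powr p"
    using holomorphic_powr_modulus[OF g] by blast
  define X where "X = 1 - (cmod z)\<^sup>2"
  \<comment> \<open>Half the distance to the boundary keeps the ball inside the disk and changes 1 -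
    |v|^2 by a factor of at most 4 in either direction.\<close>
  define r where "r = (1 - cmod z) / 2"
  have X: "0 < X" using disk_points(3)[OF z z] by (simp add: X_def)
  have r: "0 < r" using z by (simp add: r_def)
  have X_fac: "X = (1 - cmod z) * (1 + cmod z)" by (simp add: X_def power2_eq_square algebra_simps)
  have rX: "X \<le> 4 * r"
    using mult_left_mono[of "1 + cmod z" 2 "1 - cmod z"] z by (simp add: X_fac r_def)
  have in_disk: "v \<in> \<bbbD>" and comp: "X \<le> 4 * (1 - (cmod v)\<^sup>2)" "1 - (cmod v)\<^sup>2 \<le> 4 * X"
    if "v \<in> ball z r" for v
  proof -
    have d: "cmod v - cmod z < r" "cmod z - cmod v < r"
      using that norm_triangle_ineq2[of v z] norm_triangle_ineq2[of z v]
      by (simp_all add: dist_norm norm_minus_commute)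
    moreover have "cmod z < 1" using z by simp
    ultimately have "cmod v < 1" unfolding r_def by argo
    then show "v \<in> \<bbbD>" by simp
    have 1: "1 - cmod z \<le> 2 * (1 - cmod v)" "1 - cmod v \<le> 3 / 2 * (1 - cmod z)"
      using d by (auto simp: r_def)
    have 2: "1 + cmod z \<le> 2 * (1 + cmod v)" "1 + cmod v \<le> 2 * (1 + cmod z)"
      using z \<open>v \<in> \<bbbD>\<close> norm_ge_zero[of z] norm_ge_zero[of v] unfolding mem_ball_0 by argo+
    have "X \<le> (2 * (1 - cmod v)) * (2 * (1 + cmod v))"
      unfolding X_fac using 1 2 z by (intro mult_mono) auto
    then show "X \<le> 4 * (1 - (cmod v)\<^sup>2)" by (simp add: power2_eq_square algebra_simps)
    have "(1 - cmod v) * (1 + cmod v) \<le> (3 / 2 * (1 - cmod z)) * (2 * (1 + cmod z))"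
      using 1 2 z \<open>v \<in> \<bbbD>\<close> by (intro mult_mono) auto
    then show "1 - (cmod v)\<^sup>2 \<le> 4 * X"
      unfolding X_fac using X by (simp add: X_fac power2_eq_square algebra_simps)
  qed
  define w where "w = c * (4 powr - \<bar>\<gamma>\<bar> * X powr \<gamma>)"
  have w: "0 < w" using c X by (simp add: w_def c_def)
  have "m * X powr (2 + \<gamma>) = w * (pi * (X / 4)\<^sup>2)"
    using X by (simp add: m_def w_def powr_add power2_eq_square)
  also have "\<dots> \<le> w * (pi * r\<^sup>2)"
    using w X rX by (intro mult_left_mono power_mono) auto
  finally have mX: "m * X powr (2 + \<gamma>) \<le> w * (pi * r\<^sup>2)" .
  have Gmeas: "(\<lambda>v. ennreal (cmod (G v))) \<in> borel_measurable (disk_measure \<gamma>)"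
    by (intro measurable_compose[OF _ measurable_ennreal] borel_measurable_disk_measureI
          continuous_intros holomorphic_on_imp_continuous_on G)
  have "ennreal (m * X powr (2 + \<gamma>) * cmod (G z)) \<le> ennreal (w * (pi * r\<^sup>2) * cmod (G z))"
    using mX by (intro ennreal_leI mult_right_mono) auto
  also have "\<dots> = ennreal w * ennreal (pi * r\<^sup>2 * cmod (G z))"
    using w by (simp add: ennreal_mult[symmetric] mult.assoc)
  also have "\<dots> \<le> ennreal w * (\<integral>\<^sup>+v. ennreal (cmod (G v)) * indicator (ball z r) v \<partial>lborel)"
  proof (intro mult_left_mono holomorphic_area_mean_le)
    show "G holomorphic_on ball z r"
      using in_disk by (intro holomorphic_on_subset[OF G(1)] subsetI)
  qed (use r in auto)
  also have "\<dots> = (\<integral>\<^sup>+v. ennreal w * (ennreal (cmod (G v)) * indicator (ball z r) v) \<partial>lborel)"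
  proof (rule nn_integral_cmult[symmetric])
    have "(\<lambda>v. indicator (ball z r) v *\<^sub>R cmod (G v)) \<in> borel_measurable borel"
      using in_disk by (intro borel_measurable_continuous_on_indicator continuous_intros
          continuous_on_subset[OF holomorphic_on_imp_continuous_on[OF G(1)]]) auto
    then have "(\<lambda>v. ennreal (indicator (ball z r) v *\<^sub>R cmod (G v))) \<in> borel_measurable borel"
      by simp
    also have "(\<lambda>v. ennreal (indicator (ball z r) v *\<^sub>R cmod (G v)))
        = (\<lambda>v. ennreal (cmod (G v)) * indicator (ball z r) v)"
      by (auto simp: indicator_def)
    finally show "(\<lambda>v. ennreal (cmod (G v)) * indicator (ball z r) v) \<in> borel_measurable lborel"
      by simp
  qed
  also have "\<dots> \<le> (\<integral>\<^sup>+v. ennreal (weight_const \<gamma> * (1 - (cmod v)\<^sup>2) powr \<gamma>) * ennreal (cmod (G v)) * indicator \<bbbD> v \<partial>lborel)"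
  proof (intro nn_integral_mono)
    fix v
    show "ennreal w * (ennreal (cmod (G v)) * indicator (ball z r) v)
      \<le> ennreal (weight_const \<gamma> * (1 - (cmod v)\<^sup>2) powr \<gamma>) * ennreal (cmod (G v)) * indicator \<bbbD> v"
    proof (cases "v \<in> ball z r")
      case True
      have "w \<le> c * (1 - (cmod v)\<^sup>2) powr \<gamma>"
        unfolding w_def using c comp[OF True] X disk_points(3)[of v v] in_disk[OF True]
        by (intro mult_left_mono powr_comparable) (auto simp: c_def)
      then show ?thesis
        using True in_disk[OF True] by (auto simp: c_def intro!: mult_right_mono ennreal_leI)
    qed simp
  qed
  also have "\<dots> = (\<integral>\<^sup>+v. ennreal (cmod (G v)) \<partial>disk_measure \<gamma>)"
    by (rule nn_integral_disk_measure[OF Gmeas, symmetric])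
  finally have main: "ennreal (m * X powr (2 + \<gamma>) * cmod (G z)) \<le> (\<integral>\<^sup>+v. ennreal (cmod (G v)) \<partial>disk_measure \<gamma>)" .
  have "ennreal (cmod (G z)) = ennreal (1 / m * X powr - (2 + \<gamma>)) * ennreal (m * X powr (2 + \<gamma>) * cmod (G z))"
    using m X by (simp add: ennreal_mult[symmetric] powr_add[symmetric] powr_minus field_simps)
  also have "\<dots> \<le> ennreal (1 / m * X powr - (2 + \<gamma>)) * (\<integral>\<^sup>+v. ennreal (cmod (G v)) \<partial>disk_measure \<gamma>)"
    by (rule mult_left_mono[OF main]) simp
  also have "(\<integral>\<^sup>+v. ennreal (cmod (G v)) \<partial>disk_measure \<gamma>) = (\<integral>\<^sup>+v. ennreal (cmod (g v) powr p) \<partial>disk_measure \<gamma>)"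
    by (intro nn_integral_cong) (simp add: G)
  finally show "ennreal (cmod (g z) powr p)
      \<le> ennreal (1 / m * (1 - (cmod z)\<^sup>2) powr - (2 + \<gamma>)) * (\<integral>\<^sup>+v. ennreal (cmod (g v) powr p) \<partial>disk_measure \<gamma>)"
    by (simp add: G(2)[OF z] X_def)
qed

subsection \<open>Geometry of the disk\<close>

text \<open>This is 1 - |phi_a(u)|^2 for the Moebius involution phi_a
  (\<open>one_minus_cmod_disk_swap\<close>), a conformally invariant measure of closeness to the
  boundary as seen from \<open>a\<close>.\<close>

definition disk_height :: "complex \<Rightarrow> complex \<Rightarrow> real" where
  "disk_height a u = (1 - (cmod a)\<^sup>2) * (1 - (cmod u)\<^sup>2) / (cmod (1 - u * cnj a))\<^sup>2"

text \<open>With N = 2 + \<gamma>, its N-th power is |k_z(u)| |k_a(z)| (1 - |z|^2)^(N/2) / |k_a(u)|.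
  It is the factor that changes the base point of the kernel from \<open>a\<close> to
  \<open>z\<close>.\<close>

definition disk_ratio :: "complex \<Rightarrow> complex \<Rightarrow> complex \<Rightarrow> real" where
  "disk_ratio a u z = (1 - (cmod z)\<^sup>2) * cmod (1 - u * cnj a) / (cmod (1 - u * cnj z) * cmod (1 - z * cnj a))"

text \<open>The disk automorphism that exchanges 0 and \<open>a\<close>; it is its own inverse
  (\<open>disk_swap_swap\<close>).\<close>

definition disk_swap :: "complex \<Rightarrow> complex \<Rightarrow> complex" where
  "disk_swap a z = (a - z) / (1 - z * cnj a)"

text \<open>The polarised form serves two purposes: on the diagonal it yields the height, and off
  the diagonal it transforms the factor |1 - u cnj z| of \<open>disk_ratio\<close>.\<close>

lemma disk_swap_identity:
  assumes "a \<in> \<bbbD>" "z \<in> \<bbbD>" "w \<in> \<bbbD>"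
  shows "1 - disk_swap a z * cnj (disk_swap a w)
    = (1 - a * cnj a) * (1 - z * cnj w) / ((1 - z * cnj a) * (1 - a * cnj w))"
proof -
  have "1 - z * cnj a \<noteq> 0" "1 - w * cnj a \<noteq> 0"
    using disk_points(1)[OF assms(1,2)] disk_points(1)[OF assms(1,3)] by auto
  moreover from this have "1 - a * cnj w \<noteq> 0"
    by (metis complex_cnj_cnj complex_cnj_diff complex_cnj_mult complex_cnj_one complex_cnj_zero mult.commute)
  ultimately show ?thesis
    by (simp add: disk_swap_def mult.commute[of "cnj w"] divide_simps) (simp add: algebra_simps)
qed

lemma disk_swap_one_minus:
  assumes "a \<in> \<bbbD>" "z \<in> \<bbbD>"
  shows "1 - disk_swap a z * cnj a = (1 - a * cnj a) / (1 - z * cnj a)"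
proof -
  have "1 - z * cnj a \<noteq> 0"
    using disk_points(1)[OF assms] by auto
  then show ?thesis
    by (simp add: disk_swap_def divide_simps) (simp add: algebra_simps)
qed

lemma disk_swap_swap:
  assumes "a \<in> \<bbbD>" "z \<in> \<bbbD>"
  shows "disk_swap a (disk_swap a z) = z"
proof -
  have nz: "1 - z * cnj a \<noteq> 0" "1 - a * cnj a \<noteq> 0"
    using disk_points(1)[OF assms] disk_points(1)[OF assms(1,1)] by auto
  have "a - disk_swap a z = z * (1 - a * cnj a) / (1 - z * cnj a)"
    using nz by (simp add: disk_swap_def divide_simps) (simp add: algebra_simps)
  then show ?thesis
    unfolding disk_swap_def[of a "disk_swap a z"] disk_swap_one_minus[OF assms] using nz by simp
qed

lemma cmod_one_minus_commute: "cmod (1 - z * cnj w) = cmod (1 - w * cnj z)"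
  by (metis complex_cnj_cnj complex_cnj_diff complex_cnj_mult complex_cnj_one complex_mod_cnj mult.commute)

lemma one_minus_cmod_disk_swap:
  assumes "a \<in> \<bbbD>" "z \<in> \<bbbD>"
  shows "1 - (cmod (disk_swap a z))\<^sup>2 = disk_height a z"
proof -
  have "complex_of_real (1 - (cmod (disk_swap a z))\<^sup>2) = 1 - disk_swap a z * cnj (disk_swap a z)"
    by (simp add: complex_norm_square[symmetric])
  also have "\<dots> = (1 - a * cnj a) * (1 - z * cnj z) / ((1 - z * cnj a) * cnj (1 - z * cnj a))"
    by (simp add: disk_swap_identity[OF assms assms(2)] mult.commute)
  also have "\<dots> = complex_of_real (disk_height a z)"
    unfolding disk_height_def of_real_divide of_real_mult of_real_diff of_real_1 complex_norm_square ..
  finally show ?thesis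
    using of_real_eq_iff by blast
qed

lemma disk_height_pos:
  assumes "a \<in> \<bbbD>" "z \<in> \<bbbD>"
  shows "0 < disk_height a z"
  using disk_points[OF assms] disk_points[OF assms(2,2)] by (simp add: disk_height_def)

lemma disk_swap_in_disk:
  assumes "a \<in> \<bbbD>" "z \<in> \<bbbD>"
  shows "disk_swap a z \<in> \<bbbD>"
proof -
  have "(cmod (disk_swap a z))\<^sup>2 < 1"
    using disk_height_pos[OF assms] one_minus_cmod_disk_swap[OF assms] by argo
  then show ?thesis by (simp add: abs_square_less_1)
qed

text \<open>With \<open>\<phi>\<close> the involution \<^term>\<open>disk_swap a\<close>, the point is \<open>\<phi>(\<zeta>)\<close> where \<open>\<zeta>\<close> lies on the radius through
  \<open>\<phi>(u)\<close>; pulling back by \<open>\<phi>\<close> turns the ratio into \<open>(1 - |\<zeta>|\<^sup>2) / |1 - \<zeta> \<phi>(u)|\<close>, the second factor in the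
  denominator being conjugated.\<close>

lemma disk_point_above:
  assumes a: "a \<in> \<bbbD>" and u: "u \<in> \<bbbD>" and \<rho>: "disk_height a u < \<rho>" "\<rho> \<le> 1"
  obtains z where "z \<in> \<bbbD>" "disk_height a z = 3 / 4 * \<rho>" "3 / 7 \<le> disk_ratio a u z"
proof
  have \<rho>0: "0 < \<rho>" using disk_height_pos[OF a u] \<rho> by simp
  define v where "v = disk_swap a u"
  have v: "v \<in> \<bbbD>" "1 - (cmod v)\<^sup>2 < \<rho>" "disk_swap a v = u"
    using disk_swap_in_disk[OF a u] one_minus_cmod_disk_swap[OF a u] \<rho>(1) disk_swap_swap[OF a u]
    by (auto simp: v_def)
  have v0: "v \<noteq> 0" using v(2) \<rho>(2) by auto
  \<comment> \<open>With this modulus the height is exactly 3/4 of \<rho>, strictly inside the ring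
    between \<rho>/2 and \<rho>, which leaves room for a ball around the point.\<close>
  define s where "s = sqrt (1 - 3 / 4 * \<rho>)"
  have s2: "s\<^sup>2 = 1 - 3 / 4 * \<rho>" using \<rho>(2) by (simp add: s_def)
  have s: "0 \<le> s" "s < 1"
    using \<rho>0 \<rho>(2) by (auto simp: s_def)
  define \<zeta> where "\<zeta> = of_real s * sgn v"
  have \<zeta>n: "cmod \<zeta> = s" using v0 s by (simp add: \<zeta>_def norm_mult norm_sgn)
  have \<zeta>: "\<zeta> \<in> \<bbbD>" using \<zeta>n s by simp
  define z where "z = disk_swap a \<zeta>"
  show z: "disk_swap a \<zeta> \<in> \<bbbD>" by (rule disk_swap_in_disk[OF a \<zeta>])
  show h: "disk_height a (disk_swap a \<zeta>) = 3 / 4 * \<rho>"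
    using one_minus_cmod_disk_swap[OF a z] disk_swap_swap[OF a \<zeta>] \<zeta>n s2 by simp
  have "v * cnj \<zeta> = of_real (s * cmod v)"
  proof -
    have "v * cnj \<zeta> = of_real s * (v * cnj v) / of_real (cmod v)"
      by (simp add: \<zeta>_def sgn_eq)
    also have "\<dots> = of_real s * (of_real (cmod v))\<^sup>2 / of_real (cmod v)"
      by (simp add: complex_norm_square[symmetric])
    also have "\<dots> = of_real (s * cmod v)"
      using v0 by (simp add: power2_eq_square)
    finally show ?thesis .
  qed
  then have v\<zeta>: "cmod (1 - v * cnj \<zeta>) = \<bar>1 - s * cmod v\<bar>"
    by (metis norm_of_real of_real_1 of_real_diff)
  have sv: "s * cmod v < 1"
    using mult_strict_mono'[of s 1 "cmod v" 1] s v(1) by simp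
  have "s\<^sup>2 \<le> s" "(cmod v)\<^sup>2 \<le> cmod v"
    using s v(1) by (auto simp: power2_eq_square mult_left_le_one_le)
  \<comment> \<open>The denominator 1 - s|v| is at most (1 - s) + (1 - |v|), hence at most 7/4 of
    \<rho>. The numerator 1 - s^2 is 3/4 of \<rho>, and the quotient gives 3/7.\<close>
  then have bds: "1 - s \<le> 3 / 4 * \<rho>" "1 - cmod v \<le> \<rho>"
    using s2 v(2) by auto
  have "1 - s * cmod v \<le> (1 - s) + (1 - cmod v)"
    using mult_nonneg_nonneg[of "1 - s" "1 - cmod v"] s v(1) by (simp add: algebra_simps)
  then have le: "1 - s * cmod v \<le> 7 / 4 * \<rho>" using bds by linarith
  have e1: "cmod (1 - u * cnj a) = (1 - (cmod a)\<^sup>2) / cmod (1 - v * cnj a)"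
    using disk_swap_one_minus[OF a v(1)] v(3) by (simp add: norm_divide cmod_one_minus_self[OF a])
  have e2: "cmod (1 - z * cnj a) = (1 - (cmod a)\<^sup>2) / cmod (1 - \<zeta> * cnj a)"
    using disk_swap_one_minus[OF a \<zeta>] by (simp add: norm_divide cmod_one_minus_self[OF a] z_def)
  have e3: "cmod (1 - u * cnj z)
      = (1 - (cmod a)\<^sup>2) * (1 - s * cmod v) / (cmod (1 - v * cnj a) * cmod (1 - \<zeta> * cnj a))"
    using disk_swap_identity[OF a v(1) \<zeta>] v(3) v\<zeta> sv
    by (simp add: norm_divide norm_mult cmod_one_minus_self[OF a] z_def cmod_one_minus_commute[of a \<zeta>])
  have e4: "1 - (cmod z)\<^sup>2 = (1 - (cmod a)\<^sup>2) * (1 - s\<^sup>2) / (cmod (1 - \<zeta> * cnj a))\<^sup>2"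
    using one_minus_cmod_disk_swap[OF a \<zeta>] \<zeta>n by (simp add: z_def disk_height_def)
  \<comment> \<open>Every factor that depends on \<open>a\<close> cancels.\<close>
  have alg: "d * T / A\<^sup>2 * (d / V) / (d * L / (V * A) * (d / A)) = T / L"
    if "0 < d" "0 < A" "0 < V" "0 < L" for d T A V L :: real
    using that by (simp add: field_simps power2_eq_square)
  have "disk_ratio a u z = (1 - s\<^sup>2) / (1 - s * cmod v)"
    unfolding disk_ratio_def e1 e2 e3 e4
    by (rule alg) (use disk_points[OF a \<zeta>] disk_points(1)[OF a v(1)] sv in simp_all)
  moreover have "3 / 7 \<le> (1 - s\<^sup>2) / (1 - s * cmod v)"
    using sv le \<rho>0 by (simp add: s2 pos_le_divide_eq)
  ultimately show "3 / 7 \<le> disk_ratio a u (disk_swap a \<zeta>)"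
    by (simp add: z_def)
qed

text \<open>The displacement is at most (1 - |z0|)/16, and 1 - |z0| is at most |1 - z0 cnj b|. So
  the relative change is at most 1/16 for all \<open>b\<close> at once; it is used for both
  \<open>a\<close> and \<open>u\<close>.\<close>

lemma cmod_one_minus_near:
  assumes z0: "z0 \<in> \<bbbD>" and z: "z \<in> ball z0 ((1 - cmod z0) / 16)" and b: "b \<in> \<bbbD>"
  shows "\<bar>cmod (1 - z * cnj b) - cmod (1 - z0 * cnj b)\<bar> \<le> cmod (1 - z0 * cnj b) / 16"
proof -
  have "\<bar>cmod (1 - z * cnj b) - cmod (1 - z0 * cnj b)\<bar> \<le> cmod ((z0 - z) * cnj b)"
    using norm_triangle_ineq3[of "1 - z * cnj b" "1 - z0 * cnj b"] by (simp add: algebra_simps)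
  also have "\<dots> \<le> cmod (z0 - z)"
    using b by (simp add: norm_mult mult_left_le)
  also have "\<dots> \<le> (1 - cmod z0) / 16"
    using z by (simp add: dist_norm)
  also have "1 - cmod z0 \<le> 1 - cmod (z0 * cnj b)"
    using b by (simp add: norm_mult mult_left_le)
  also have "\<dots> \<le> cmod (1 - z0 * cnj b)"
    using norm_triangle_ineq2[of 1 "z0 * cnj b"] by simp
  finally show ?thesis by simp
qed

lemma one_minus_cmod_near:
  assumes z0: "z0 \<in> \<bbbD>" and z: "z \<in> ball z0 ((1 - cmod z0) / 16)"
  shows "z \<in> \<bbbD>" "1 - (cmod z)\<^sup>2 \<le> 3 * (1 - cmod z0)"
    "\<bar>(1 - (cmod z)\<^sup>2) - (1 - (cmod z0)\<^sup>2)\<bar> \<le> (1 - (cmod z0)\<^sup>2) / 8"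
proof -
  have d': "cmod z - cmod z0 \<le> (1 - cmod z0) / 16" "cmod z0 - cmod z \<le> (1 - cmod z0) / 16"
    using z norm_triangle_ineq2[of z z0] norm_triangle_ineq2[of z0 z]
    by (simp_all add: dist_norm norm_minus_commute)
  then have d: "\<bar>cmod z - cmod z0\<bar> \<le> (1 - cmod z0) / 16"
    by (intro abs_leI) auto
  have le: "cmod z \<le> 1 - 15 / 16 * (1 - cmod z0)" using d' by argo
  moreover have "cmod z0 < 1" using z0 by simp
  ultimately have "cmod z < 1" by argo
  then show zD: "z \<in> \<bbbD>" by simp
  have "(1 - cmod z) * (1 + cmod z) \<le> (17 / 16 * (1 - cmod z0)) * 2"
    using d' zD z0 by (intro mult_mono) auto
  then show "1 - (cmod z)\<^sup>2 \<le> 3 * (1 - cmod z0)"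
    using z0 by (simp add: power2_eq_square algebra_simps)
  have "\<bar>(1 - (cmod z)\<^sup>2) - (1 - (cmod z0)\<^sup>2)\<bar> = \<bar>cmod z - cmod z0\<bar> * (cmod z + cmod z0)"
  proof -
    have "(1 - (cmod z)\<^sup>2) - (1 - (cmod z0)\<^sup>2) = - ((cmod z - cmod z0) * (cmod z + cmod z0))"
      by (simp add: power2_eq_square algebra_simps)
    then show ?thesis by (simp only: abs_minus_cancel abs_mult) simp
  qed
  also have "\<dots> \<le> (1 - cmod z0) / 16 * 2"
    using d zD z0 by (intro mult_mono) auto
  also have "\<dots> \<le> (1 - (cmod z0)\<^sup>2) / 8"
    using z0 by (simp add: power2_eq_square mult_left_le)
  finally show "\<bar>(1 - (cmod z)\<^sup>2) - (1 - (cmod z0)\<^sup>2)\<bar> \<le> (1 - (cmod z0)\<^sup>2) / 8" .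
qed

text \<open>The factors change by at most 1/16 or 1/8 relatively. The height 3/4 of \<rho> is
  therefore multiplied by something between (7/8)/(17/16)^2 and (9/8)/(15/16)^2, which stays between
  \<rho>/2 and \<rho>, and the ratio keeps at least 3/7 * (7/8)/(17/16)^2 > 1/4.\<close>

lemma disk_ball_above:
  assumes a: "a \<in> \<bbbD>" and u: "u \<in> \<bbbD>" and \<rho>: "disk_height a u < \<rho>" "\<rho> \<le> 1"
  obtains z0 where "z0 \<in> \<bbbD>"
    "\<And>z. z \<in> ball z0 ((1 - cmod z0) / 16) \<Longrightarrow> z \<in> \<bbbD> \<and> 1 - (cmod z)\<^sup>2 \<le> 3 * (1 - cmod z0)
        \<and> \<rho> / 2 \<le> disk_height a z \<and> disk_height a z < \<rho> \<and> 1 / 4 \<le> disk_ratio a u z"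
proof -
  obtain z0 where z0: "z0 \<in> \<bbbD>" "disk_height a z0 = 3 / 4 * \<rho>" "3 / 7 \<le> disk_ratio a u z0"
    using disk_point_above[OF a u \<rho>] by blast
  have \<rho>0: "0 < \<rho>" using disk_height_pos[OF a u] \<rho> by simp
  show thesis
  proof (rule that[OF z0(1)])
    fix z assume z: "z \<in> ball z0 ((1 - cmod z0) / 16)"
    note near = one_minus_cmod_near[OF z0(1) z]
    define A B where "A = cmod (1 - z0 * cnj a)" and "B = cmod (1 - z * cnj a)"
    define X Y where "X = 1 - (cmod z0)\<^sup>2" and "Y = 1 - (cmod z)\<^sup>2"
    define P Q where "P = cmod (1 - u * cnj z0)" and "Q = cmod (1 - u * cnj z)"
    define d where "d = 1 - (cmod a)\<^sup>2"
    define t where "t = cmod (1 - u * cnj a)"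
    have pos: "0 < A" "0 < B" "0 < X" "0 < Y" "0 < P" "0 < Q" "0 < d" "0 < t"
      using disk_points[OF a z0(1)] disk_points[OF a near(1)] disk_points(1)[OF z0(1) u]
        disk_points(1)[OF near(1) u] disk_points(3)[OF near(1,1)] disk_points(3)[OF z0(1,1)]
        disk_points(1)[OF a u]
      by (auto simp: A_def B_def X_def Y_def P_def Q_def d_def t_def)
    have AB: "15 / 16 * A \<le> B" "B \<le> 17 / 16 * A"
      using cmod_one_minus_near[OF z0(1) z a] unfolding A_def B_def abs_le_iff by argo+
    have PQ: "Q \<le> 17 / 16 * P"
      using cmod_one_minus_near[OF z0(1) z u]
      unfolding P_def Q_def abs_le_iff cmod_one_minus_commute[of u z] cmod_one_minus_commute[of u z0] by argo
    have XY: "7 / 8 * X \<le> Y" "Y \<le> 9 / 8 * X"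
      using near(3) unfolding X_def Y_def abs_le_iff by argo+
    have h0: "d * X = 3 / 4 * \<rho> * A\<^sup>2"
      using z0(2) pos by (simp add: disk_height_def A_def X_def d_def field_simps)
    have B2: "(15 / 16 * A)\<^sup>2 \<le> B\<^sup>2" "B\<^sup>2 \<le> (17 / 16 * A)\<^sup>2"
      using AB pos by (auto intro!: power_mono)
    have "\<rho> / 2 * B\<^sup>2 \<le> \<rho> / 2 * (17 / 16 * A)\<^sup>2"
      using B2 \<rho>0 by (intro mult_left_mono) auto
    also have "\<dots> \<le> 7 / 8 * (3 / 4 * \<rho> * A\<^sup>2)"
      using \<rho>0 pos by (simp add: power_mult_distrib power2_eq_square)
    also have "\<dots> = d * (7 / 8 * X)" unfolding h0[symmetric] by simp
    also have "\<dots> \<le> d * Y" using XY pos by (intro mult_left_mono) auto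
    finally have h1: "\<rho> / 2 \<le> disk_height a z"
      using pos by (simp add: disk_height_def B_def[symmetric] Y_def[symmetric] d_def[symmetric] pos_le_divide_eq)
    have "d * Y \<le> d * (9 / 8 * X)" using XY pos by (intro mult_left_mono) auto
    also have "\<dots> = 9 / 8 * (3 / 4 * \<rho> * A\<^sup>2)" unfolding h0[symmetric] by simp
    also have "\<dots> < \<rho> * (15 / 16 * A)\<^sup>2"
      using \<rho>0 pos by (simp add: power_mult_distrib power2_eq_square)
    also have "\<dots> \<le> \<rho> * B\<^sup>2" using B2 \<rho>0 by (intro mult_left_mono) auto
    finally have h2: "disk_height a z < \<rho>"
      using pos by (simp add: disk_height_def B_def[symmetric] Y_def[symmetric] d_def[symmetric] pos_divide_less_eq)
    have r0: "3 / 7 * (P * A) \<le> X * t"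
      using z0(3) pos
      by (simp add: disk_ratio_def A_def[symmetric] X_def[symmetric] P_def[symmetric] t_def[symmetric] pos_le_divide_eq)
    have "1 / 4 * (Q * B) \<le> 1 / 4 * ((17 / 16 * P) * (17 / 16 * A))"
      using PQ AB pos by (intro mult_left_mono mult_mono) auto
    also have "\<dots> \<le> 7 / 8 * (3 / 7 * (P * A))"
      using pos by simp
    also have "\<dots> \<le> (7 / 8 * X) * t" using r0 by (simp add: mult_ac)
    also have "\<dots> \<le> Y * t" using XY pos by (intro mult_right_mono) auto
    finally have "1 / 4 \<le> disk_ratio a u z"
      using pos
      by (simp add: disk_ratio_def B_def[symmetric] Y_def[symmetric] Q_def[symmetric] t_def[symmetric] pos_le_divide_eq)
    with near h1 h2 show "z \<in> \<bbbD> \<and> 1 - (cmod z)\<^sup>2 \<le> 3 * (1 - cmod z0)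
        \<and> \<rho> / 2 \<le> disk_height a z \<and> disk_height a z < \<rho> \<and> 1 / 4 \<le> disk_ratio a u z"
      by simp
  qed
qed

subsection \<open>Decay towards the boundary\<close>

lemma continuous_on_disk_height: "a \<in> \<bbbD> \<Longrightarrow> continuous_on \<bbbD> (disk_height a)"
  unfolding disk_height_def using disk_points(1)[of a]
  by (intro continuous_intros) fastforce

lemma continuous_on_disk_ratio:
  assumes "a \<in> \<bbbD>" "u \<in> \<bbbD>"
  shows "continuous_on \<bbbD> (disk_ratio a u)"
proof -
  have "cmod (1 - u * cnj z) * cmod (1 - z * cnj a) \<noteq> 0" if "z \<in> \<bbbD>" for z
    using disk_points(1)[OF that assms(2)] disk_points(1)[OF assms(1) that] by simp
  then show ?thesis
    unfolding disk_ratio_def by (intro continuous_intros) auto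
qed

lemma continuous_on_disk_powr:
  "continuous_on \<bbbD> (\<lambda>z::complex. (1 - (cmod z)\<^sup>2) powr s)"
  using disk_points(3) by (intro continuous_intros) fastforce

definition disk_ring :: "complex \<Rightarrow> real \<Rightarrow> complex set" where
  "disk_ring a \<rho> = {z. \<rho> / 2 \<le> disk_height a z \<and> disk_height a z < \<rho>}"

text \<open>Against area measure the integrand on the ball of \<open>disk_ball_above\<close> is the
  ratio power times c (1 - |z|^2)^(-2). With d = 1 - |z0| this is at least c (1/4)^s / (9 d^2),
  while the ball has area pi d^2 / 256. The scale d cancels, and 9 * 256 = 2304.\<close>

lemma kernel_mass_in_ring:
  assumes a: "a \<in> \<bbbD>" and u: "u \<in> \<bbbD>" and \<rho>: "disk_height a u < \<rho>" "\<rho> \<le> 1" and s: "0 \<le> s"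
  shows "ennreal (weight_const \<gamma> * (1 / 4) powr s * pi / 2304)
    \<le> (\<integral>\<^sup>+z. ennreal (disk_ratio a u z powr s * (1 - (cmod z)\<^sup>2) powr - (2 + \<gamma>))
          * indicator (disk_ring a \<rho>) z \<partial>disk_measure \<gamma>)"
proof -
  define c where "c = weight_const \<gamma>"
  have c: "0 \<le> c" by (simp add: c_def weight_const_nonneg)
  obtain z0 where z0: "z0 \<in> \<bbbD>" and
    ball: "\<And>z. z \<in> ball z0 ((1 - cmod z0) / 16) \<Longrightarrow> z \<in> \<bbbD> \<and> 1 - (cmod z)\<^sup>2 \<le> 3 * (1 - cmod z0)
        \<and> \<rho> / 2 \<le> disk_height a z \<and> disk_height a z < \<rho> \<and> 1 / 4 \<le> disk_ratio a u z"
    using disk_ball_above[OF a u \<rho>] by blast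
  define d where "d = 1 - cmod z0"
  have d: "0 < d" using z0 by (simp add: d_def)
  have [measurable]: "disk_height a \<in> borel_measurable (disk_measure \<gamma>)"
    "disk_ratio a u \<in> borel_measurable (disk_measure \<gamma>)"
    "(\<lambda>z. (1 - (cmod z)\<^sup>2) powr - (2 + \<gamma>)) \<in> borel_measurable (disk_measure \<gamma>)"
    by (intro borel_measurable_disk_measureI continuous_on_disk_height continuous_on_disk_ratio
        continuous_on_disk_powr a u)+
  have ind: "indicator (disk_ring a \<rho>) = (\<lambda>z. if \<rho> / 2 \<le> disk_height a z \<and> disk_height a z < \<rho> then 1 else 0 :: ennreal)"
    by (auto simp: disk_ring_def indicator_def)
  have "ennreal (c * (1 / 4) powr s * pi / 2304)
      = ennreal (c * (1 / 4) powr s * (1 / (9 * d\<^sup>2))) * ennreal (pi * (d / 16)\<^sup>2)"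
    using d c by (simp add: ennreal_mult[symmetric] power2_eq_square)
  also have "\<dots> = (\<integral>\<^sup>+z. ennreal (c * (1 / 4) powr s * (1 / (9 * d\<^sup>2))) * indicator (ball z0 (d / 16)) z \<partial>lborel)"
    using d by (simp add: emeasure_ball_complex nn_integral_cmult_indicator)
  also have "\<dots> \<le> (\<integral>\<^sup>+z. ennreal (weight_const \<gamma> * (1 - (cmod z)\<^sup>2) powr \<gamma>) *
      (ennreal (disk_ratio a u z powr s * (1 - (cmod z)\<^sup>2) powr - (2 + \<gamma>))
          * indicator (disk_ring a \<rho>) z) * indicator \<bbbD> z \<partial>lborel)"
  proof (intro nn_integral_mono)
    fix z
    show "ennreal (c * (1 / 4) powr s * (1 / (9 * d\<^sup>2))) * indicator (ball z0 (d / 16)) z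
      \<le> ennreal (weight_const \<gamma> * (1 - (cmod z)\<^sup>2) powr \<gamma>) *
      (ennreal (disk_ratio a u z powr s * (1 - (cmod z)\<^sup>2) powr - (2 + \<gamma>))
          * indicator (disk_ring a \<rho>) z) * indicator \<bbbD> z"
    proof (cases "z \<in> ball z0 (d / 16)")
      case True
      note z = ball[OF True[unfolded d_def]]
      define X where "X = 1 - (cmod z)\<^sup>2"
      have X: "0 < X" "X \<le> 3 * d"
        using z disk_points(3)[of z z] by (auto simp: X_def d_def)
      have "X\<^sup>2 \<le> (3 * d)\<^sup>2" using X by (intro power_mono) auto
      then have "1 / (9 * d\<^sup>2) \<le> 1 / X\<^sup>2"
        using X d by (intro divide_left_mono) (auto simp: power_mult_distrib)
      then have "c * (1 / 4) powr s * (1 / (9 * d\<^sup>2)) \<le> c * disk_ratio a u z powr s * (1 / X\<^sup>2)"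
        using c s z by (intro mult_mono powr_mono2) auto
      also have "1 / X\<^sup>2 = X powr \<gamma> * X powr - (2 + \<gamma>)"
      proof -
        have "X powr \<gamma> * X powr - (2 + \<gamma>) = X powr - 2"
          by (simp add: powr_add[symmetric])
        also have "\<dots> = 1 / X\<^sup>2"
          using X by (simp add: powr_minus divide_inverse)
        finally show ?thesis by simp
      qed
      finally show ?thesis
        using True z c X
        by (auto simp: disk_ring_def ennreal_mult[symmetric] c_def[symmetric] X_def[symmetric] mult_ac intro!: ennreal_leI)
    qed simp
  qed
  also have "\<dots> = (\<integral>\<^sup>+z. ennreal (disk_ratio a u z powr s * (1 - (cmod z)\<^sup>2) powr - (2 + \<gamma>))
          * indicator (disk_ring a \<rho>) z \<partial>disk_measure \<gamma>)"
    unfolding ind by (rule nn_integral_disk_measure[symmetric]) measurable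
  finally show ?thesis by (simp add: c_def)
qed

text \<open>An A_1-type condition. The power -(2 + \<gamma>) turns the measure in \<open>z\<close>
  into a multiple of the invariant measure, so the same kernel, integrated in \<open>z\<close>
  instead of \<open>u\<close>, has the scale-free lower bound of
  \<open>kernel_mass_in_ring\<close>.\<close>

definition dominates_average :: "real \<Rightarrow> real \<Rightarrow> real \<Rightarrow> complex \<Rightarrow> (complex \<Rightarrow> ennreal) \<Rightarrow> bool" where
  "dominates_average \<gamma> s D a \<phi> \<longleftrightarrow> (\<forall>z\<in>\<bbbD>.
    (\<integral>\<^sup>+u. \<phi> u * ennreal (disk_ratio a u z powr s * (1 - (cmod z)\<^sup>2) powr - (2 + \<gamma>)) \<partial>disk_measure \<gamma>)
      \<le> ennreal D * \<phi> z)"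

text \<open>The double integral of \<open>\<phi> u * K u z\<close> over \<open>z\<close> in the ring
  is estimated in both orders. Integrating first in \<open>z\<close> gives at least \<open>k\<close>
  times \<open>\<phi> u\<close> for each \<open>u\<close> in the tail; integrating first in
  \<open>u\<close> gives at most \<open>D\<close> times \<open>\<phi> z\<close>.\<close>

lemma tail_le_ring:
  assumes a: "a \<in> \<bbbD>" and \<rho>: "0 < \<rho>" "\<rho> \<le> 1" and s: "0 \<le> s"
    and \<phi>[measurable]: "\<phi> \<in> borel_measurable (disk_measure \<gamma>)"
    and dom: "dominates_average \<gamma> s D a \<phi>"
  shows "ennreal (weight_const \<gamma> * (1 / 4) powr s * pi / 2304)
        * (\<integral>\<^sup>+u. \<phi> u * indicator {u. disk_height a u < \<rho>} u \<partial>disk_measure \<gamma>)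
      \<le> ennreal D * (\<integral>\<^sup>+z. \<phi> z * indicator (disk_ring a \<rho>) z \<partial>disk_measure \<gamma>)"
proof -
  let ?\<mu> = "disk_measure \<gamma>"
  define k where "k = ennreal (weight_const \<gamma> * (1 / 4) powr s * pi / 2304)"
  define K where "K u z = ennreal (disk_ratio a u z powr s * (1 - (cmod z)\<^sup>2) powr - (2 + \<gamma>))" for u z
  interpret \<mu>: sigma_finite_measure ?\<mu> by (rule sigma_finite_disk_measure)
  interpret P: pair_sigma_finite ?\<mu> ?\<mu> ..
  have id [measurable]: "(\<lambda>z. z) \<in> borel_measurable ?\<mu>"
    by (intro borel_measurable_disk_measureI continuous_intros)
  have [measurable]: "fst \<in> borel_measurable (?\<mu> \<Otimes>\<^sub>M ?\<mu>)" "snd \<in> borel_measurable (?\<mu> \<Otimes>\<^sub>M ?\<mu>)"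
    using measurable_compose[OF measurable_fst id] measurable_compose[OF measurable_snd id] by simp_all
  have [measurable]: "cnj \<in> borel_measurable borel"
    by (intro borel_measurable_continuous_onI continuous_intros)
  have [measurable]: "disk_height a \<in> borel_measurable borel"
    unfolding disk_height_def by measurable
  have [measurable]: "(\<lambda>p. disk_ratio a (fst p) (snd p)) \<in> borel_measurable (?\<mu> \<Otimes>\<^sub>M ?\<mu>)"
    unfolding disk_ratio_def by measurable
  have [measurable]: "(\<lambda>p. K (fst p) (snd p)) \<in> borel_measurable (?\<mu> \<Otimes>\<^sub>M ?\<mu>)"
    unfolding K_def by measurable
  have Kz [measurable]: "(\<lambda>u. K u z) \<in> borel_measurable ?\<mu>" for z
    unfolding K_def disk_ratio_def by measurable
  have Ku [measurable]: "(\<lambda>z. K u z) \<in> borel_measurable ?\<mu>" for u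
    unfolding K_def disk_ratio_def by measurable
  have [measurable]: "disk_ring a \<rho> \<in> sets borel" "{u. disk_height a u < \<rho>} \<in> sets borel"
    unfolding disk_ring_def by measurable
  have [measurable]: "indicator (disk_ring a \<rho>) \<in> borel_measurable ?\<mu>"
    "indicator {u. disk_height a u < \<rho>} \<in> borel_measurable ?\<mu>"
    by (rule measurable_compose[OF id borel_measurable_indicator]; measurable)+
  have "k * (\<integral>\<^sup>+u. \<phi> u * indicator {u. disk_height a u < \<rho>} u \<partial>?\<mu>)
      = (\<integral>\<^sup>+u. k * (\<phi> u * indicator {u. disk_height a u < \<rho>} u) \<partial>?\<mu>)"
    by (rule nn_integral_cmult[symmetric]) measurable
  also have "\<dots> \<le> (\<integral>\<^sup>+u. \<phi> u * (\<integral>\<^sup>+z. K u z * indicator (disk_ring a \<rho>) z \<partial>?\<mu>) \<partial>?\<mu>)"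
  proof (intro nn_integral_mono)
    fix u assume "u \<in> space ?\<mu>"
    then have u: "u \<in> \<bbbD>" by simp
    show "k * (\<phi> u * indicator {u. disk_height a u < \<rho>} u)
        \<le> \<phi> u * (\<integral>\<^sup>+z. K u z * indicator (disk_ring a \<rho>) z \<partial>?\<mu>)"
    proof (cases "disk_height a u < \<rho>")
      case True
      then show ?thesis
        using mult_left_mono[OF kernel_mass_in_ring[OF a u True \<rho>(2) s, of \<gamma>], of "\<phi> u"]
        by (simp add: k_def K_def mult.commute)
    qed simp
  qed
  also have "\<dots> = (\<integral>\<^sup>+u. \<integral>\<^sup>+z. \<phi> u * K u z * indicator (disk_ring a \<rho>) z \<partial>?\<mu> \<partial>?\<mu>)"
    by (intro nn_integral_cong) (simp add: nn_integral_cmult[symmetric] mult.assoc)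
  also have "\<dots> = (\<integral>\<^sup>+z. \<integral>\<^sup>+u. \<phi> u * K u z * indicator (disk_ring a \<rho>) z \<partial>?\<mu> \<partial>?\<mu>)"
    by (rule P.Fubini'[symmetric]) (simp add: case_prod_unfold)
  also have "\<dots> = (\<integral>\<^sup>+z. (\<integral>\<^sup>+u. \<phi> u * K u z \<partial>?\<mu>) * indicator (disk_ring a \<rho>) z \<partial>?\<mu>)"
    by (intro nn_integral_cong) (simp add: nn_integral_multc)
  also have "\<dots> \<le> (\<integral>\<^sup>+z. ennreal D * (\<phi> z * indicator (disk_ring a \<rho>) z) \<partial>?\<mu>)"
    using dom unfolding dominates_average_def K_def
    by (intro nn_integral_mono) (auto simp: mult.assoc[symmetric] intro!: mult_right_mono)
  also have "\<dots> = ennreal D * (\<integral>\<^sup>+z. \<phi> z * indicator (disk_ring a \<rho>) z \<partial>?\<mu>)"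
    by (rule nn_integral_cmult) measurable
  finally show ?thesis by (simp add: k_def)
qed

text \<open>The ring at scale 2^(-n) is the difference of two consecutive tails. Since it carries at
  least the proportion k/D of the larger tail, the smaller one is at most 1 - k/D times the
  larger.\<close>

lemma tail_geometric_decay:
  assumes a: "a \<in> \<bbbD>" and s: "0 \<le> s" and D: "0 < D"
    and \<phi>[measurable]: "\<phi> \<in> borel_measurable (disk_measure \<gamma>)"
    and dom: "dominates_average \<gamma> s D a \<phi>"
    and fin: "(\<integral>\<^sup>+u. \<phi> u \<partial>disk_measure \<gamma>) < \<infinity>"
    and \<beta>: "0 \<le> \<beta>" "1 - weight_const \<gamma> * (1 / 4) powr s * pi / 2304 / D \<le> \<beta>"
  shows "(\<integral>\<^sup>+u. \<phi> u * indicator {u. disk_height a u < (1 / 2) ^ n} u \<partial>disk_measure \<gamma>)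
    \<le> ennreal (\<beta> ^ n) * (\<integral>\<^sup>+u. \<phi> u \<partial>disk_measure \<gamma>)"
proof (induction n)
  case 0
  show ?case by (auto intro!: nn_integral_mono simp: indicator_def)
next
  case (Suc n)
  let ?\<mu> = "disk_measure \<gamma>"
  define k where "k = weight_const \<gamma> * (1 / 4) powr s * pi / 2304"
  have k: "0 \<le> k" by (simp add: k_def weight_const_nonneg)
  define T where "T m = (\<integral>\<^sup>+u. \<phi> u * indicator {u. disk_height a u < (1 / 2) ^ m} u \<partial>?\<mu>)" for m
  define R where "R = (\<integral>\<^sup>+u. \<phi> u * indicator (disk_ring a ((1 / 2) ^ n)) u \<partial>?\<mu>)"
  have [measurable]: "disk_height a \<in> borel_measurable ?\<mu>"
    by (intro borel_measurable_disk_measureI continuous_on_disk_height a)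
  have ind: "(indicator {u. disk_height a u < r} :: _ \<Rightarrow> ennreal) = (\<lambda>u. if disk_height a u < r then 1 else 0)"
    "(indicator (disk_ring a r) :: _ \<Rightarrow> ennreal) = (\<lambda>z. if r / 2 \<le> disk_height a z \<and> disk_height a z < r then 1 else 0)"
    for r
    by (auto simp: disk_ring_def indicator_def)
  have le: "T m \<le> (\<integral>\<^sup>+u. \<phi> u \<partial>?\<mu>)" for m
    unfolding T_def by (auto intro!: nn_integral_mono simp: indicator_def)
  have half: "h < (1 / 2) ^ n" if "h * 2 < (1 / 2) ^ n" for h :: real
  proof -
    have "(0::real) < (1 / 2) ^ n" by simp
    then show ?thesis using that by argo
  qed
  have split: "T n = T (Suc n) + R"
    unfolding T_def R_def ind
    by (subst nn_integral_add[symmetric]) (auto intro!: nn_integral_cong dest: half)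
  have ring: "ennreal k * T n \<le> ennreal D * R"
    using tail_le_ring[OF a _ _ s \<phi> dom, of "(1 / 2) ^ n"] by (simp add: k_def T_def R_def power_le_one)
  obtain t r t' where eq: "T n = ennreal t" "R = ennreal r" "T (Suc n) = ennreal t'"
    and nn: "0 \<le> t" "0 \<le> r" "0 \<le> t'"
  \<comment> \<open>Finite total mass lets the identity between tails and ring be subtracted in the
    reals.\<close>
  proof -
    have "T n < \<infinity>" "T (Suc n) < \<infinity>" using le fin le_less_trans by blast+
    moreover from this have "R < \<infinity>" using split by (simp add: less_top)
    ultimately show thesis using that by (metis enn2real_nonneg ennreal_enn2real infinity_ennreal_def)
  qed
  have 1: "t = t' + r" using split nn by (simp add: eq ennreal_plus[symmetric] del: ennreal_plus)
  have 2: "k * t \<le> D * r" using ring nn k D by (simp add: eq ennreal_mult[symmetric])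
  have "t' \<le> (1 - k / D) * t"
    using 1 2 D by (simp add: field_simps)
  also have "\<dots> \<le> \<beta> * t" using \<beta>(2) nn by (intro mult_right_mono) (simp_all add: k_def)
  finally have "T (Suc n) \<le> ennreal \<beta> * T n"
    using \<beta>(1) nn by (simp add: eq ennreal_mult[symmetric] ennreal_leI)
  also have "\<dots> \<le> ennreal \<beta> * (ennreal (\<beta> ^ n) * (\<integral>\<^sup>+u. \<phi> u \<partial>?\<mu>))"
    using Suc unfolding T_def by (intro mult_left_mono) auto
  finally show ?case
    using \<beta>(1) by (simp add: T_def ennreal_mult mult.assoc)
qed

lemma dyadic_bracket:
  fixes h :: real
  assumes "0 < h" "h < 1"
  obtains n where "(1 / 2) ^ Suc n \<le> h" "h < (1 / 2) ^ n"
proof -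
  define m where "m = (LEAST m. (1 / 2) ^ m \<le> h)"
  obtain m' where "(1 / 2) ^ m' < h"
    using real_arch_pow_inv[OF assms(1), of "1 / 2"] by auto
  then have m: "(1 / 2) ^ m \<le> h"
    using LeastI[of "\<lambda>m. (1 / 2) ^ m \<le> h" m'] by (simp add: m_def)
  have "m \<noteq> 0" using m assms(2) by (cases m) auto
  then obtain n where n: "m = Suc n" by (cases m) auto
  have "\<not> (1 / 2) ^ n \<le> h"
    using not_less_Least[of n "\<lambda>m. (1 / 2) ^ m \<le> h"] n by (simp add: m_def)
  then show thesis using that m n by auto
qed

text \<open>A layer-cake estimate over dyadic heights: the weight grows by
  \<open>2 powr \<eta>\<close> per level while the tail shrinks by \<open>\<beta>\<close>, so the
  condition on their product makes the series converge.\<close>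

lemma nn_integral_height_powr_le:
  assumes a: "a \<in> \<bbbD>" and s: "0 \<le> s" and D: "0 < D"
    and \<phi>[measurable]: "\<phi> \<in> borel_measurable (disk_measure \<gamma>)"
    and dom: "dominates_average \<gamma> s D a \<phi>"
    and fin: "(\<integral>\<^sup>+u. \<phi> u \<partial>disk_measure \<gamma>) < \<infinity>"
    and \<beta>: "0 \<le> \<beta>" "1 - weight_const \<gamma> * (1 / 4) powr s * pi / 2304 / D \<le> \<beta>"
    and \<eta>: "0 \<le> \<eta>" "2 powr \<eta> * \<beta> < 1"
  shows "(\<integral>\<^sup>+u. \<phi> u * ennreal (disk_height a u powr - \<eta>) \<partial>disk_measure \<gamma>)
    \<le> ennreal (1 + 2 powr \<eta> / (1 - 2 powr \<eta> * \<beta>)) * (\<integral>\<^sup>+u. \<phi> u \<partial>disk_measure \<gamma>)"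
proof -
  let ?\<mu> = "disk_measure \<gamma>"
  define I where "I = (\<integral>\<^sup>+u. \<phi> u \<partial>?\<mu>)"
  define q where "q = 2 powr \<eta>"
  have q: "0 < q" "q * \<beta> < 1" "0 \<le> q * \<beta>" using \<eta> \<beta> by (auto simp: q_def)
  define J where "J n u = (if disk_height a u < (1 / 2) ^ n then 1 else 0 :: ennreal)" for n u
  have J: "indicator {u. disk_height a u < (1 / 2) ^ n} u = J n u" for n u
    by (auto simp: J_def indicator_def)
  have [measurable]: "disk_height a \<in> borel_measurable ?\<mu>"
    by (intro borel_measurable_disk_measureI continuous_on_disk_height a)
  have [measurable]: "J n \<in> borel_measurable ?\<mu>" for n
    unfolding J_def by measurable
  \<comment> \<open>If the height lies between 2^(-n-1) and 2^(-n), the single term with index n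
    already dominates. The summand 1 covers height at least 1, as at u = a.\<close>
  have pt: "ennreal (disk_height a u powr - \<eta>) \<le> 1 + (\<Sum>n. ennreal (q ^ Suc n) * J n u)" if u: "u \<in> \<bbbD>" for u
  proof (cases "disk_height a u < 1")
    case False
    then have "disk_height a u powr - \<eta> \<le> 1"
      using \<eta>(1) powr_mono2'[of "- \<eta>" 1 "disk_height a u"] by simp
    then have "ennreal (disk_height a u powr - \<eta>) \<le> 1"
      by (metis ennreal_1 ennreal_leI)
    then show ?thesis by (rule order_trans) simp
  next
    case True
    obtain n where n: "(1 / 2) ^ Suc n \<le> disk_height a u" "disk_height a u < (1 / 2) ^ n"
      using dyadic_bracket[OF disk_height_pos[OF a u] True] by blast
    have "disk_height a u powr - \<eta> \<le> ((1 / 2) ^ Suc n) powr - \<eta>"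
      using \<eta>(1) n(1) by (intro powr_mono2') auto
    also have "\<dots> = q ^ Suc n"
      by (simp add: q_def powr_powr powr_realpow[symmetric] powr_minus powr_divide inverse_eq_divide
          powr_add[symmetric] field_simps del: power_Suc)
    finally have "ennreal (disk_height a u powr - \<eta>) \<le> ennreal (q ^ Suc n) * J n u"
      using n(2) by (simp add: J_def ennreal_leI)
    also have "\<dots> \<le> (\<Sum>n. ennreal (q ^ Suc n) * J n u)"
      using sum_le_suminf[of "\<lambda>n. ennreal (q ^ Suc n) * J n u" "{n}"] by simp
    also have "\<dots> \<le> 1 + \<dots>" by simp
    finally show ?thesis .
  qed
  have "(\<integral>\<^sup>+u. \<phi> u * ennreal (disk_height a u powr - \<eta>) \<partial>?\<mu>)
      \<le> (\<integral>\<^sup>+u. \<phi> u * (1 + (\<Sum>n. ennreal (q ^ Suc n) * J n u)) \<partial>?\<mu>)"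
    by (intro nn_integral_mono mult_left_mono pt) auto
  also have "\<dots> = (\<integral>\<^sup>+u. \<phi> u + (\<Sum>n. ennreal (q ^ Suc n) * (\<phi> u * J n u)) \<partial>?\<mu>)"
    by (simp only: distrib_left mult_1_right ennreal_suminf_cmult[symmetric] mult.left_commute)
  also have "\<dots> = I + (\<Sum>n. ennreal (q ^ Suc n) * (\<integral>\<^sup>+u. \<phi> u * J n u \<partial>?\<mu>))"
    by (simp add: nn_integral_add nn_integral_suminf nn_integral_cmult I_def)
  also have "\<dots> \<le> I + (\<Sum>n. ennreal (q ^ Suc n) * (ennreal (\<beta> ^ n) * I))"
    using tail_geometric_decay[OF a s D \<phi> dom fin \<beta>] unfolding J I_def[symmetric]
    by (intro add_left_mono suminf_le mult_left_mono) auto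
  also have "(\<Sum>n. ennreal (q ^ Suc n) * (ennreal (\<beta> ^ n) * I)) = (\<Sum>n. ennreal (q * (q * \<beta>) ^ n)) * I"
  proof -
    have "ennreal (q ^ Suc n) * (ennreal (\<beta> ^ n) * I) = ennreal (q * (q * \<beta>) ^ n) * I" for n
      using q \<beta> by (simp add: mult.assoc[symmetric] ennreal_mult[symmetric] power_mult_distrib)
    then show ?thesis by (simp only: ennreal_suminf_multc)
  qed
  also have "(\<Sum>n. ennreal (q * (q * \<beta>) ^ n)) = ennreal (q / (1 - q * \<beta>))"
  proof -
    have "(\<lambda>n. q * (q * \<beta>) ^ n) sums (q * (1 / (1 - q * \<beta>)))"
      using q by (intro sums_mult geometric_sums) auto
    then show ?thesis
      using q by (subst suminf_ennreal_eq[of _ "q / (1 - q * \<beta>)"]) auto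
  qed
  also have "I + ennreal (q / (1 - q * \<beta>)) * I = ennreal (1 + q / (1 - q * \<beta>)) * I"
    using q by (simp add: ennreal_plus distrib_right)
  finally show ?thesis by (simp add: I_def q_def)
qed

subsection \<open>The reverse Hoelder inequality\<close>

text \<open>At r = p the kernel power (1 - 2/p) p and the square in the Berezin transform combine to
  the exponent p, so this is the p-th power of the mean in the hypothesis
  (\<open>berezin_mean_diag\<close>).\<close>

definition kernel_mean :: "real \<Rightarrow> real \<Rightarrow> (complex \<Rightarrow> complex) \<Rightarrow> complex \<Rightarrow> ennreal" where
  "kernel_mean \<gamma> p f a =
    (\<integral>\<^sup>+u. ennreal ((cmod (f u) * cmod (bergman_kernel \<gamma> a u)) powr p) \<partial>disk_measure \<gamma>)"

text \<open>Both sides are monomials in the same five positive quantities, so taking logarithms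
  leaves a linear identity in the exponents. It rewrites an average of |f k_a|^p as a kernel mean at
  \<open>z\<close> times a factor free of \<open>u\<close>.\<close>

lemma kernel_ratio_identity:
  assumes a: "a \<in> \<bbbD>" and u: "u \<in> \<bbbD>" and z: "z \<in> \<bbbD>"
  shows "cmod (bergman_kernel \<gamma> a u) powr p
      * (disk_ratio a u z powr ((2 + \<gamma>) * p) * (1 - (cmod z)\<^sup>2) powr - (2 + \<gamma>))
    = cmod (bergman_kernel \<gamma> z u) powr p
      * (cmod (bergman_kernel \<gamma> a z) powr p * (1 - (cmod z)\<^sup>2) powr - ((2 + \<gamma>) * (1 - p / 2)))"
proof -
  define N where "N = 2 + \<gamma>"
  have "(A powr (N / 2) / U powr N) powr p * ((X * U / (Q * B)) powr (N * p) * X powr - N)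
      = (X powr (N / 2) / Q powr N) powr p
        * ((A powr (N / 2) / B powr N) powr p * X powr - (N * (1 - p / 2)))"
    if "0 < A" "0 < U" "0 < X" "0 < Q" "0 < B" for A U X Q B :: real
    using that by (simp add: powr_def ln_mult ln_div exp_add[symmetric] exp_diff[symmetric]) (simp add: algebra_simps)
  then show ?thesis
    using disk_points[OF a u] disk_points[OF a z] disk_points[OF z u]
    unfolding cmod_bergman_kernel disk_ratio_def N_def by blast
qed

text \<open>The weight lost in the pointwise bound and the surplus of the kernel exponent combine
  into a pure power of the height. This is where the exponent 1 - 2/p of the kernel matters.\<close>

lemma kernel_height_identity:
  assumes a: "a \<in> \<bbbD>" and u: "u \<in> \<bbbD>"
  shows "(1 - (cmod u)\<^sup>2) powr (- (2 + \<gamma>) * t) * cmod (bergman_kernel \<gamma> a u) powr (- 2 * t)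
    = disk_height a u powr - ((2 + \<gamma>) * t)"
proof -
  define N where "N = 2 + \<gamma>"
  have "X powr (- N * t) * (A powr (N / 2) / U powr N) powr (- 2 * t) = (A * X / U\<^sup>2) powr - (N * t)"
    if "0 < A" "0 < U" "0 < X" for A U X :: real
    using that by (simp add: powr_def ln_mult ln_div ln_realpow exp_add[symmetric] exp_diff[symmetric])
      (simp add: algebra_simps)
  then show ?thesis
    using disk_points[OF a u] disk_points[OF u u]
    unfolding cmod_bergman_kernel disk_height_def N_def by blast
qed

lemma kernel_product:
  assumes f: "f holomorphic_on \<bbbD>" "\<And>v. v \<in> \<bbbD> \<Longrightarrow> f v \<noteq> 0" and a: "a \<in> \<bbbD>"
  shows "(\<lambda>u. f u * bergman_kernel \<gamma> a u) holomorphic_on \<bbbD>"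
    and "\<And>v. v \<in> \<bbbD> \<Longrightarrow> f v * bergman_kernel \<gamma> a v \<noteq> 0"
    and "(\<lambda>u. ennreal ((cmod (f u) * cmod (bergman_kernel \<gamma> a u)) powr p)) \<in> borel_measurable (disk_measure \<gamma>)"
proof -
  show 1: "(\<lambda>u. f u * bergman_kernel \<gamma> a u) holomorphic_on \<bbbD>"
    using bergman_kernel_holomorphic_on[OF a] f(1) by (intro holomorphic_intros)
  show 2: "\<And>v. v \<in> \<bbbD> \<Longrightarrow> f v * bergman_kernel \<gamma> a v \<noteq> 0"
    using f(2) bergman_kernel_pos[OF a] by fastforce
  have "continuous_on \<bbbD> (\<lambda>u. cmod (f u * bergman_kernel \<gamma> a u) powr p)"
    using 2 by (intro continuous_intros holomorphic_on_imp_continuous_on[OF 1]) auto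
  from borel_measurable_disk_measureI[OF this]
  show "(\<lambda>u. ennreal ((cmod (f u) * cmod (bergman_kernel \<gamma> a u)) powr p)) \<in> borel_measurable (disk_measure \<gamma>)"
    by (simp add: norm_mult)
qed

text \<open>After \<open>kernel_ratio_identity\<close> the factor free of \<open>u\<close> cancels
  the power of 1 - |z|^2 in the hypothesis. The constant \<open>D\<close> does not depend on
  \<open>a\<close>, which makes the later estimates uniform in \<open>a\<close>.\<close>

lemma dominates_average_kernel:
  assumes f: "f holomorphic_on \<bbbD>" "\<And>v. v \<in> \<bbbD> \<Longrightarrow> f v \<noteq> 0" and a: "a \<in> \<bbbD>" and D: "0 \<le> D"
    and W: "\<And>z. z \<in> \<bbbD> \<Longrightarrow> kernel_mean \<gamma> p f z
      \<le> ennreal (D * (cmod (f z) powr p * (1 - (cmod z)\<^sup>2) powr ((2 + \<gamma>) * (1 - p / 2))))"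
  shows "dominates_average \<gamma> ((2 + \<gamma>) * p) D a
    (\<lambda>u. ennreal ((cmod (f u) * cmod (bergman_kernel \<gamma> a u)) powr p))"
  unfolding dominates_average_def
proof
  fix z assume z: "z \<in> \<bbbD>"
  define b where "b = cmod (bergman_kernel \<gamma> a z) powr p * (1 - (cmod z)\<^sup>2) powr - ((2 + \<gamma>) * (1 - p / 2))"
  have b: "0 \<le> b" by (simp add: b_def)
  have X: "0 < 1 - (cmod z)\<^sup>2" by (rule disk_points(3)[OF z z])
  have "(\<integral>\<^sup>+u. ennreal ((cmod (f u) * cmod (bergman_kernel \<gamma> a u)) powr p)
        * ennreal (disk_ratio a u z powr ((2 + \<gamma>) * p) * (1 - (cmod z)\<^sup>2) powr - (2 + \<gamma>)) \<partial>disk_measure \<gamma>)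
      = (\<integral>\<^sup>+u. ennreal ((cmod (f u) * cmod (bergman_kernel \<gamma> z u)) powr p) * ennreal b \<partial>disk_measure \<gamma>)"
  proof (intro nn_integral_cong)
    fix u assume "u \<in> space (disk_measure \<gamma>)"
    then have u: "u \<in> \<bbbD>" by simp
    show "ennreal ((cmod (f u) * cmod (bergman_kernel \<gamma> a u)) powr p)
        * ennreal (disk_ratio a u z powr ((2 + \<gamma>) * p) * (1 - (cmod z)\<^sup>2) powr - (2 + \<gamma>))
      = ennreal ((cmod (f u) * cmod (bergman_kernel \<gamma> z u)) powr p) * ennreal b"
      using kernel_ratio_identity[OF a u z, of \<gamma> p] b
      unfolding b_def[symmetric] by (simp add: ennreal_mult[symmetric] powr_mult mult.assoc)
  qed
  also have "\<dots> = kernel_mean \<gamma> p f z * ennreal b"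
    unfolding kernel_mean_def by (rule nn_integral_multc[OF kernel_product(3)[OF f z]])
  also have "\<dots> \<le> ennreal (D * (cmod (f z) powr p * (1 - (cmod z)\<^sup>2) powr ((2 + \<gamma>) * (1 - p / 2)))) * ennreal b"
    by (rule mult_right_mono[OF W[OF z]]) simp
  also have "\<dots> = ennreal D * ennreal ((cmod (f z) * cmod (bergman_kernel \<gamma> a z)) powr p)"
  proof -
    have "(1 - (cmod z)\<^sup>2) powr ((2 + \<gamma>) * (1 - p / 2)) * (1 - (cmod z)\<^sup>2) powr - ((2 + \<gamma>) * (1 - p / 2)) = 1"
      using X by (simp add: powr_add[symmetric] del: powr_minus)
    then show ?thesis
      using D b by (simp add: ennreal_mult[symmetric] b_def powr_mult mult.assoc mult.left_commute[of _ "_ powr - _"])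
  qed
  finally show "(\<integral>\<^sup>+u. ennreal ((cmod (f u) * cmod (bergman_kernel \<gamma> a u)) powr p)
        * ennreal (disk_ratio a u z powr ((2 + \<gamma>) * p) * (1 - (cmod z)\<^sup>2) powr - (2 + \<gamma>)) \<partial>disk_measure \<gamma>)
      \<le> ennreal D * ennreal ((cmod (f z) * cmod (bergman_kernel \<gamma> a z)) powr p)" .
qed

text \<open>With t = \<epsilon>/p the integrand is |f k_a|^p times a small power t of itself and
  \<open>k powr (- 2 * t)\<close>. The small power is bounded pointwise, and the resulting negative
  power of the height is absorbed by \<open>nn_integral_height_powr_le\<close>. Every small
  \<epsilon> is allowed, so that a common one can be chosen for f and 1/f.\<close>

lemma reverse_hoelder_kernel_mean:
  assumes c: "0 < weight_const \<gamma>" and \<gamma>: "- 2 < \<gamma>" and p: "0 < p" and D: "0 < D"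
    and f: "f holomorphic_on \<bbbD>" "\<And>v. v \<in> \<bbbD> \<Longrightarrow> f v \<noteq> 0"
    and W: "\<And>z. z \<in> \<bbbD> \<Longrightarrow> kernel_mean \<gamma> p f z
      \<le> ennreal (D * (cmod (f z) powr p * (1 - (cmod z)\<^sup>2) powr ((2 + \<gamma>) * (1 - p / 2))))"
  obtains \<epsilon>\<^sub>0 where "0 < \<epsilon>\<^sub>0"
    and "\<And>\<epsilon>. 0 < \<epsilon> \<Longrightarrow> \<epsilon> \<le> \<epsilon>\<^sub>0 \<Longrightarrow> \<exists>C\<ge>0. \<forall>a\<in>\<bbbD>.
      (\<integral>\<^sup>+u. ennreal (cmod (f u) powr (p + \<epsilon>) * cmod (bergman_kernel \<gamma> a u) powr (p + \<epsilon> * (1 - 2 / p))) \<partial>disk_measure \<gamma>)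
        \<le> ennreal (C * enn2real (kernel_mean \<gamma> p f a) powr ((p + \<epsilon>) / p))"
proof -
  define N where "N = 2 + \<gamma>"
  have N: "0 < N" using \<gamma> by (simp add: N_def)
  obtain C\<^sub>0 where C\<^sub>0: "0 < C\<^sub>0"
    and pointwise: "\<And>g p z. g holomorphic_on \<bbbD> \<Longrightarrow> (\<And>v. v \<in> \<bbbD> \<Longrightarrow> g v \<noteq> 0) \<Longrightarrow> z \<in> \<bbbD> \<Longrightarrow>
      ennreal (cmod (g z) powr p)
        \<le> ennreal (C\<^sub>0 * (1 - (cmod z)\<^sup>2) powr - N) * (\<integral>\<^sup>+v. ennreal (cmod (g v) powr p) \<partial>disk_measure \<gamma>)"
    using bergman_pointwise_bound[OF c] unfolding N_def by blast
  \<comment> \<open>The maximum with 1/2 keeps \<open>\<beta>\<close> positive, so that its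
    logarithm can be taken. Half of the critical exponent then leaves the strict inequality of
    \<open>geom\<close>.\<close>
  define \<beta> where "\<beta> = max (1 / 2) (1 - weight_const \<gamma> * (1 / 4) powr (N * p) * pi / 2304 / D)"
  have \<beta>: "0 < \<beta>" "\<beta> < 1" using c D by (auto simp: \<beta>_def)
  define \<eta>\<^sub>0 where "\<eta>\<^sub>0 = - log 2 \<beta> / 2"
  have \<eta>\<^sub>0: "0 < \<eta>\<^sub>0" using \<beta> by (simp add: \<eta>\<^sub>0_def)
  have geom: "2 powr \<eta> * \<beta> < 1" if "\<eta> \<le> \<eta>\<^sub>0" for \<eta>
  proof -
    have "2 powr \<eta> * \<beta> = 2 powr (\<eta> + log 2 \<beta>)"
      using \<beta> by (simp add: powr_add)
    also have "\<dots> < 2 powr 0"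
      using that \<eta>\<^sub>0 unfolding \<eta>\<^sub>0_def by (intro powr_less_mono) auto
    finally show ?thesis by simp
  qed
  show thesis
  proof
    \<comment> \<open>This threshold is the condition that the height exponent \<eta> = N \<epsilon>
      / p does not exceed \<open>\<eta>\<^sub>0\<close>.\<close>
    show "0 < p * \<eta>\<^sub>0 / N" using p \<eta>\<^sub>0 N by simp
    fix \<epsilon> assume \<epsilon>: "0 < \<epsilon>" "\<epsilon> \<le> p * \<eta>\<^sub>0 / N"
    define t where "t = \<epsilon> / p"
    define \<eta> where "\<eta> = N * t"
    have t: "0 < t" using \<epsilon> p by (simp add: t_def)
    have \<eta>: "0 \<le> \<eta>" "\<eta> \<le> \<eta>\<^sub>0" using \<epsilon> p N by (auto simp: \<eta>_def t_def field_simps)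
    define C\<^sub>1 where "C\<^sub>1 = 1 + 2 powr \<eta> / (1 - 2 powr \<eta> * \<beta>)"
    have C\<^sub>1: "0 \<le> C\<^sub>1" using geom[OF \<eta>(2)] by (simp add: C\<^sub>1_def)
    show "\<exists>C\<ge>0. \<forall>a\<in>\<bbbD>.
      (\<integral>\<^sup>+u. ennreal (cmod (f u) powr (p + \<epsilon>) * cmod (bergman_kernel \<gamma> a u) powr (p + \<epsilon> * (1 - 2 / p))) \<partial>disk_measure \<gamma>)
        \<le> ennreal (C * enn2real (kernel_mean \<gamma> p f a) powr ((p + \<epsilon>) / p))"
    proof (intro exI[of _ "C\<^sub>0 powr t * C\<^sub>1"] conjI ballI)
      show "0 \<le> C\<^sub>0 powr t * C\<^sub>1" using C\<^sub>1 by simp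
      fix a assume a: "a \<in> \<bbbD>"
      define \<phi> where "\<phi> u = (cmod (f u) * cmod (bergman_kernel \<gamma> a u)) powr p" for u
      define \<omega> where "\<omega> = enn2real (kernel_mean \<gamma> p f a)"
      have fin: "kernel_mean \<gamma> p f a < \<infinity>"
        using W[OF a] by (rule le_less_trans) simp
      have \<omega>: "kernel_mean \<gamma> p f a = ennreal \<omega>" "0 \<le> \<omega>"
        using fin by (simp_all add: \<omega>_def)
      have \<phi>_meas: "(\<lambda>u. ennreal (\<phi> u)) \<in> borel_measurable (disk_measure \<gamma>)"
        unfolding \<phi>_def by (rule kernel_product(3)[OF f a])
      have km: "kernel_mean \<gamma> p f a = (\<integral>\<^sup>+u. ennreal (\<phi> u) \<partial>disk_measure \<gamma>)"
        by (simp add: kernel_mean_def \<phi>_def)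
      have pt: "cmod (f u) powr (p + \<epsilon>) * cmod (bergman_kernel \<gamma> a u) powr (p + \<epsilon> * (1 - 2 / p))
          \<le> (C\<^sub>0 * \<omega>) powr t * (\<phi> u * disk_height a u powr - \<eta>)" if u: "u \<in> \<bbbD>" for u
      proof -
        define X where "X = 1 - (cmod u)\<^sup>2"
        define F where "F = cmod (f u)"
        define k where "k = cmod (bergman_kernel \<gamma> a u)"
        have pos: "0 < X" "0 < F" "0 < k"
          using disk_points(3)[OF u u] f(2)[OF u] bergman_kernel_pos[OF a u]
          by (auto simp: X_def F_def k_def)
        have "ennreal (\<phi> u) \<le> ennreal (C\<^sub>0 * X powr - N) * ennreal \<omega>"
          using pointwise[OF kernel_product(1,2)[OF f a] u, of \<gamma> p]
          by (simp add: norm_mult \<phi>_def[symmetric] km[symmetric] \<omega>(1) X_def)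
        then have "\<phi> u \<le> C\<^sub>0 * X powr - N * \<omega>"
          using C\<^sub>0 \<omega>(2) by (simp add: ennreal_mult[symmetric])
        then have "\<phi> u powr t \<le> (C\<^sub>0 * X powr - N * \<omega>) powr t"
          using t by (intro powr_mono2) (auto simp: \<phi>_def)
        also have "\<dots> = (C\<^sub>0 * \<omega>) powr t * X powr (- N * t)"
          using C\<^sub>0 \<omega>(2) pos by (simp add: powr_mult powr_powr)
        finally have *: "\<phi> u powr t \<le> (C\<^sub>0 * \<omega>) powr t * X powr (- N * t)" .
        have "F powr (p + \<epsilon>) * k powr (p + \<epsilon> * (1 - 2 / p)) = \<phi> u * (\<phi> u powr t * k powr (- 2 * t))"
          unfolding \<phi>_def F_def[symmetric] k_def[symmetric] t_def using pos p
          by (simp add: powr_mult powr_powr powr_add[symmetric] mult_ac)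
            (simp add: powr_add[symmetric] mult.assoc[symmetric] algebra_simps)
        also have "\<dots> \<le> \<phi> u * ((C\<^sub>0 * \<omega>) powr t * X powr (- N * t) * k powr (- 2 * t))"
          using * by (intro mult_left_mono mult_right_mono) (auto simp: \<phi>_def)
        also have "\<dots> = (C\<^sub>0 * \<omega>) powr t * (\<phi> u * (X powr (- N * t) * k powr (- 2 * t)))"
          by (simp add: mult_ac)
        also have "X powr (- N * t) * k powr (- 2 * t) = disk_height a u powr - \<eta>"
          using kernel_height_identity[OF a u, of \<gamma> t] by (simp add: X_def k_def N_def \<eta>_def)
        finally show ?thesis by (simp add: F_def k_def)
      qed
      have hmeas: "(\<lambda>u. ennreal (\<phi> u) * ennreal (disk_height a u powr - \<eta>)) \<in> borel_measurable (disk_measure \<gamma>)"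
      proof -
        have "continuous_on \<bbbD> (\<lambda>u. disk_height a u powr - \<eta>)"
          using disk_height_pos[OF a] by (intro continuous_intros continuous_on_disk_height a) force
        from borel_measurable_disk_measureI[OF this, of \<gamma>] \<phi>_meas show ?thesis by simp
      qed
      have "(\<integral>\<^sup>+u. ennreal (cmod (f u) powr (p + \<epsilon>) * cmod (bergman_kernel \<gamma> a u) powr (p + \<epsilon> * (1 - 2 / p))) \<partial>disk_measure \<gamma>)
          \<le> (\<integral>\<^sup>+u. ennreal ((C\<^sub>0 * \<omega>) powr t) * (ennreal (\<phi> u) * ennreal (disk_height a u powr - \<eta>)) \<partial>disk_measure \<gamma>)"
        using pt by (intro nn_integral_mono) (simp add: ennreal_mult[symmetric] \<phi>_def ennreal_leI)
      also have "\<dots> = ennreal ((C\<^sub>0 * \<omega>) powr t) * (\<integral>\<^sup>+u. ennreal (\<phi> u) * ennreal (disk_height a u powr - \<eta>) \<partial>disk_measure \<gamma>)"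
        by (rule nn_integral_cmult[OF hmeas])
      also have "\<dots> \<le> ennreal ((C\<^sub>0 * \<omega>) powr t) * (ennreal C\<^sub>1 * ennreal \<omega>)"
      proof (rule mult_left_mono)
        have "dominates_average \<gamma> (N * p) D a (\<lambda>u. ennreal (\<phi> u))"
          unfolding N_def \<phi>_def using D by (intro dominates_average_kernel f a W) auto
        then have "(\<integral>\<^sup>+u. ennreal (\<phi> u) * ennreal (disk_height a u powr - \<eta>) \<partial>disk_measure \<gamma>)
            \<le> ennreal C\<^sub>1 * (\<integral>\<^sup>+u. ennreal (\<phi> u) \<partial>disk_measure \<gamma>)"
          unfolding C\<^sub>1_def using \<beta> \<eta> geom[OF \<eta>(2)] N p D fin
          by (intro nn_integral_height_powr_le[OF a _ D \<phi>_meas]) (auto simp: km \<beta>_def)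
        then show "(\<integral>\<^sup>+u. ennreal (\<phi> u) * ennreal (disk_height a u powr - \<eta>) \<partial>disk_measure \<gamma>)
            \<le> ennreal C\<^sub>1 * ennreal \<omega>"
          by (simp add: km[symmetric] \<omega>(1))
      qed simp
      also have "\<dots> = ennreal (C\<^sub>0 powr t * C\<^sub>1 * \<omega> powr ((p + \<epsilon>) / p))"
      proof -
        have "\<omega> powr ((p + \<epsilon>) / p) = \<omega> * \<omega> powr t"
          using \<omega>(2) p by (cases "\<omega> = 0") (simp_all add: t_def add_divide_distrib powr_add)
        then show ?thesis
          using C\<^sub>0 C\<^sub>1 \<omega>(2) by (simp add: ennreal_mult[symmetric] powr_mult mult_ac)
      qed
      finally show "(\<integral>\<^sup>+u. ennreal (cmod (f u) powr (p + \<epsilon>) * cmod (bergman_kernel \<gamma> a u) powr (p + \<epsilon> * (1 - 2 / p))) \<partial>disk_measure \<gamma>)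
        \<le> ennreal (C\<^sub>0 powr t * C\<^sub>1 * enn2real (kernel_mean \<gamma> p f a) powr ((p + \<epsilon>) / p))"
        by (simp add: \<omega>_def)
    qed
  qed
qed

text \<open>The pointwise bound at the diagonal, where |k_z(z)| = (1 - |z|^2)^(-(2 + \<gamma>)/2)
  and |g(z)| = 1/|f(z)|, bounds the mean of \<open>g\<close> from below. Dividing the product bound
  by it isolates the mean of \<open>f\<close>.\<close>

lemma kernel_mean_le_of_product:
  assumes C: "0 < C" and p: "0 < p" and q: "0 < q" and pq: "1 / p + 1 / q = 1"
    and g: "g holomorphic_on \<bbbD>" "\<And>v. v \<in> \<bbbD> \<Longrightarrow> g v \<noteq> 0" and z: "z \<in> \<bbbD>" and fg: "f z * g z = 1"
    and M: "0 \<le> M" and fin: "kernel_mean \<gamma> p f z = ennreal \<omega>" "0 \<le> \<omega>" "kernel_mean \<gamma> q g z = ennreal v" "0 \<le> v"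
    and prod: "\<omega> powr (1 / p) * v powr (1 / q) \<le> M"
    and pointwise: "ennreal (cmod (g z * bergman_kernel \<gamma> z z) powr q)
        \<le> ennreal (C * (1 - (cmod z)\<^sup>2) powr - (2 + \<gamma>)) * kernel_mean \<gamma> q g z"
  shows "\<omega> \<le> (M * C powr (1 / q)) powr p * (cmod (f z) powr p * (1 - (cmod z)\<^sup>2) powr ((2 + \<gamma>) * (1 - p / 2)))"
proof -
  define N where "N = 2 + \<gamma>"
  define X where "X = 1 - (cmod z)\<^sup>2"
  have X: "0 < X" using disk_points(3)[OF z z] by (simp add: X_def)
  define F where "F = cmod (f z)"
  have fg': "F * cmod (g z) = 1"
    using arg_cong[OF fg, of cmod] by (simp add: F_def norm_mult)
  then have "F \<noteq> 0" by auto
  then have F: "0 < F" "cmod (g z) = 1 / F"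
    using fg' by (simp add: F_def) (simp add: \<open>F \<noteq> 0\<close> field_simps fg')
  have "(1 / F * X powr - (N / 2)) powr q \<le> C * X powr - N * v"
    using pointwise C fin(4) X F unfolding N_def[symmetric] X_def[symmetric] fin(3) norm_mult bergman_kernel_diag[OF z]
    by (simp add: ennreal_mult[symmetric])
  then have "((1 / F * X powr - (N / 2)) powr q) powr (1 / q) \<le> (C * X powr - N * v) powr (1 / q)"
    using q by (intro powr_mono2) auto
  then have v: "1 / F * X powr - (N / 2) \<le> C powr (1 / q) * X powr - (N / q) * v powr (1 / q)"
    using F X C fin(4) q by (simp add: powr_powr powr_mult)
  have "\<omega> powr (1 / p) = \<omega> powr (1 / p) * (1 / F * X powr - (N / 2)) * (F * X powr (N / 2))"
    using F X by (simp add: powr_minus field_simps)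
  also have "\<dots> \<le> \<omega> powr (1 / p) * (C powr (1 / q) * X powr - (N / q) * v powr (1 / q)) * (F * X powr (N / 2))"
    using v F by (intro mult_right_mono mult_left_mono) auto
  also have "\<dots> = (\<omega> powr (1 / p) * v powr (1 / q)) * (C powr (1 / q) * F * X powr (N / 2 - N / q))"
  proof -
    have "X powr (N / 2 - N / q) = X powr - (N / q) * X powr (N / 2)"
      by (simp add: powr_add[symmetric])
    then show ?thesis by (simp only: mult_ac)
  qed
  also have "\<dots> \<le> M * (C powr (1 / q) * F * X powr (N / 2 - N / q))"
    using prod F by (intro mult_right_mono) auto
  finally have "(\<omega> powr (1 / p)) powr p \<le> (M * (C powr (1 / q) * F * X powr (N / 2 - N / q))) powr p"
    using p by (intro powr_mono2) auto
  also have "\<dots> = (M * C powr (1 / q)) powr p * (F powr p * X powr ((N / 2 - N / q) * p))"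
    using M F X by (simp add: powr_mult powr_powr mult_ac)
  \<comment> \<open>The conjugacy of the exponents enters here and produces the power in the
    A_1-type bound.\<close>
  also have "(N / 2 - N / q) * p = N * (1 - p / 2)"
  proof -
    have "1 / q = 1 - 1 / p" using pq by simp
    then have "N / q = N * (1 - 1 / p)" by (metis times_divide_eq_right mult.right_neutral)
    then have "(N / 2 - N / q) * p = (N / 2 - N * (1 - 1 / p)) * p" by simp
    also have "\<dots> = N * (1 - p / 2)" using p by (simp add: field_simps)
    finally show ?thesis .
  qed
  finally show ?thesis
    using fin(2) p by (simp add: powr_powr F_def X_def N_def)
qed

section \<open>From kernel means to Berezin means\<close>

lemma berezin_mean_eq:
  assumes z: "z \<in> \<bbbD>"
  shows "berezin_mean \<gamma> p r f z = ennpowr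
    (\<integral>\<^sup>+u. ennreal (cmod (f u) powr r * cmod (bergman_kernel \<gamma> z u) powr ((1 - 2 / p) * r + 2)) \<partial>disk_measure \<gamma>) (1 / r)"
proof -
  have "ennreal (cmod (f u * bergman_kernel \<gamma> z u powr complex_of_real (1 - 2 / p)) powr r)
        * ennreal ((cmod (bergman_kernel \<gamma> z u))\<^sup>2)
      = ennreal (cmod (f u) powr r * cmod (bergman_kernel \<gamma> z u) powr ((1 - 2 / p) * r + 2))"
    if "u \<in> \<bbbD>" for u
    using bergman_kernel_pos[OF z that]
    by (simp add: norm_mult norm_powr_real_powr' powr_mult powr_powr powr_add ennreal_mult[symmetric] mult.assoc)
  then show ?thesis
    unfolding berezin_mean_def berezin_def
    by (intro arg_cong2[where f = ennpowr] nn_integral_cong) auto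
qed

lemma berezin_mean_diag:
  assumes z: "z \<in> \<bbbD>" and p: "0 < p"
  shows "berezin_mean \<gamma> p p f z = ennpowr (kernel_mean \<gamma> p f z) (1 / p)"
proof -
  have "(1 - 2 / p) * p + 2 = p" using p by (simp add: field_simps)
  then show ?thesis
    unfolding berezin_mean_eq[OF z] kernel_mean_def by (simp add: powr_mult)
qed

lemma ennpowr_le:
  assumes "x \<le> ennreal y" "0 \<le> y" "0 \<le> t"
  shows "ennpowr x t \<le> ennreal (y powr t)"
proof -
  have "x \<noteq> \<infinity>" using assms(1) by (metis ennreal_less_top infinity_ennreal_def not_le top.not_eq_extremum)
  moreover have "enn2real x \<le> y" using assms(1,2) by (simp add: enn2real_leI)
  ultimately show ?thesis
    using assms(3) by (auto simp: ennpowr_def intro!: ennreal_leI powr_mono2)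
qed

text \<open>The root of order p + \<epsilon> turns the power (p + \<epsilon>)/p of
  \<open>\<omega>\<close> into 1/p, the same power as in the original product, so the bound on that
  product applies unchanged.\<close>

lemma berezin_mean_higher_le:
  assumes z: "z \<in> \<bbbD>" and p: "0 < p" and \<epsilon>: "0 < \<epsilon>" and C: "0 \<le> C" and \<omega>: "0 \<le> \<omega>"
    and le: "(\<integral>\<^sup>+u. ennreal (cmod (f u) powr (p + \<epsilon>) * cmod (bergman_kernel \<gamma> z u) powr (p + \<epsilon> * (1 - 2 / p))) \<partial>disk_measure \<gamma>)
        \<le> ennreal (C * \<omega> powr ((p + \<epsilon>) / p))"
  shows "berezin_mean \<gamma> p (p + \<epsilon>) f z \<le> ennreal (C powr (1 / (p + \<epsilon>)) * \<omega> powr (1 / p))"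
proof -
  have e: "(1 - 2 / p) * (p + \<epsilon>) + 2 = p + \<epsilon> * (1 - 2 / p)" using p by (simp add: field_simps)
  have "berezin_mean \<gamma> p (p + \<epsilon>) f z \<le> ennreal ((C * \<omega> powr ((p + \<epsilon>) / p)) powr (1 / (p + \<epsilon>)))"
    unfolding berezin_mean_eq[OF z] e using p \<epsilon> C by (intro ennpowr_le le) auto
  then show ?thesis
    using p \<epsilon> C \<omega> by (simp add: powr_mult powr_powr)
qed

lemma berezin_mean_zero_weight:
  assumes "weight_const \<gamma> = 0"
  shows "berezin_mean \<gamma> p r f z = 0"
  by (simp add: berezin_mean_def berezin_def disk_measure_def assms ennpowr_def null_measure_eq_density[symmetric])

theorem theorem5p1:
  fixes \<gamma> p q :: real and f :: "complex \<Rightarrow> complex"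
  assumes "\<gamma> > -1" and "1 < p" and "1 / p + 1 / q = 1"
    and "f \<in> bergman_space p \<gamma>"
    and "\<forall>z\<in>\<bbbD>. f z \<noteq> 0"
    and "(\<lambda>z. 1 / f z) \<in> bergman_space q \<gamma>"
    and "(SUP z\<in>\<bbbD>. berezin_mean \<gamma> p p f z * berezin_mean \<gamma> q q (\<lambda>u. 1 / f u) z) < \<infinity>"
  shows "\<exists>\<epsilon>>0. (SUP z\<in>\<bbbD>. berezin_mean \<gamma> p (p + \<epsilon>) f z *
                          berezin_mean \<gamma> q (q + \<epsilon>) (\<lambda>u. 1 / f u) z) < \<infinity>"
proof (cases "weight_const \<gamma> = 0")
  case True
  \<comment> \<open>Only a divergent mass integral gives this junk value; then the measure is zero, so the
    convergence for \<open>\<gamma> > -1\<close> need not be proved.\<close>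
  then show ?thesis
    by (intro exI[of _ 1]) (simp add: berezin_mean_zero_weight)
next
  case False
  then have c: "0 < weight_const \<gamma>" using weight_const_nonneg[of \<gamma>] by simp
  have p: "0 < p" using assms(2) by simp
  have "1 / q = 1 - 1 / p" using assms(3) by simp
  then have "0 < 1 / q" using assms(2) by simp
  then have q: "0 < q" by simp
  have qp: "1 / q + 1 / p = 1" using assms(3) by simp
  define g where "g u = 1 / f u" for u
  have f: "f holomorphic_on \<bbbD>" "\<And>v. v \<in> \<bbbD> \<Longrightarrow> f v \<noteq> 0"
    using assms(4,5) by (auto simp: bergman_space_def)
  have g: "g holomorphic_on \<bbbD>" "\<And>v. v \<in> \<bbbD> \<Longrightarrow> g v \<noteq> 0"
    using assms(5,6) by (auto simp: bergman_space_def g_def[abs_def])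
  have fg: "f z * g z = 1" "g z * f z = 1" if "z \<in> \<bbbD>" for z
    using f(2)[OF that] by (auto simp: g_def)
  obtain C where C: "0 < C"
    and pointwise: "\<And>g p z. g holomorphic_on \<bbbD> \<Longrightarrow> (\<And>v. v \<in> \<bbbD> \<Longrightarrow> g v \<noteq> 0) \<Longrightarrow> z \<in> \<bbbD> \<Longrightarrow>
      ennreal (cmod (g z) powr p)
        \<le> ennreal (C * (1 - (cmod z)\<^sup>2) powr - (2 + \<gamma>)) * (\<integral>\<^sup>+v. ennreal (cmod (g v) powr p) \<partial>disk_measure \<gamma>)"
    using bergman_pointwise_bound[OF c] by blast
  have diag: "ennreal (cmod (h z * bergman_kernel \<gamma> z z) powr r)
        \<le> ennreal (C * (1 - (cmod z)\<^sup>2) powr - (2 + \<gamma>)) * kernel_mean \<gamma> r h z"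
    if "h holomorphic_on \<bbbD>" "\<And>v. v \<in> \<bbbD> \<Longrightarrow> h v \<noteq> 0" "z \<in> \<bbbD>" for h r z
    using pointwise[OF kernel_product(1,2)[OF that] that(3), of \<gamma> r] by (simp add: kernel_mean_def norm_mult)
  \<comment> \<open>In \<open>ennreal\<close> the product of 0 and infinity is 0, so a finite
    product alone does not make both means finite. Their positivity excludes this case.\<close>
  have mean_pos: "kernel_mean \<gamma> r h z \<noteq> 0"
    if h: "h holomorphic_on \<bbbD>" "\<And>v. v \<in> \<bbbD> \<Longrightarrow> h v \<noteq> 0" and z: "z \<in> \<bbbD>" for h r z
  proof
    assume "kernel_mean \<gamma> r h z = 0"
    with diag[OF h z, of r] have "cmod (h z * bergman_kernel \<gamma> z z) powr r \<le> 0" by simp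
    with kernel_product(2)[OF h z z, of \<gamma>] show False by simp
  qed
  obtain M where M: "0 \<le> M"
    "\<And>z. z \<in> \<bbbD> \<Longrightarrow> ennpowr (kernel_mean \<gamma> p f z) (1 / p) * ennpowr (kernel_mean \<gamma> q g z) (1 / q) \<le> ennreal M"
  proof
    let ?S = "SUP z\<in>\<bbbD>. berezin_mean \<gamma> p p f z * berezin_mean \<gamma> q q g z"
    have S: "?S < \<infinity>" using assms(7) by (simp add: g_def[abs_def])
    show "0 \<le> enn2real ?S" by simp
    fix z assume z: "z \<in> \<bbbD>"
    have "berezin_mean \<gamma> p p f z * berezin_mean \<gamma> q q g z \<le> ?S" by (rule SUP_upper[OF z])
    then show "ennpowr (kernel_mean \<gamma> p f z) (1 / p) * ennpowr (kernel_mean \<gamma> q g z) (1 / q) \<le> ennreal (enn2real ?S)"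
      using S by (simp add: berezin_mean_diag[OF z p] berezin_mean_diag[OF z q])
  qed
  define \<omega> where "\<omega> z = enn2real (kernel_mean \<gamma> p f z)" for z
  define v where "v z = enn2real (kernel_mean \<gamma> q g z)" for z
  have nn: "0 \<le> \<omega> z" "0 \<le> v z" for z by (simp_all add: \<omega>_def v_def)
  have means: "kernel_mean \<gamma> p f z = ennreal (\<omega> z)" "kernel_mean \<gamma> q g z = ennreal (v z)"
    "\<omega> z powr (1 / p) * v z powr (1 / q) \<le> M" if z: "z \<in> \<bbbD>" for z
  proof -
    have pos: "ennpowr (kernel_mean \<gamma> p f z) (1 / p) \<noteq> 0" "ennpowr (kernel_mean \<gamma> q g z) (1 / q) \<noteq> 0"
      using mean_pos[OF f z, of p] mean_pos[OF g z, of q]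
      by (auto simp: ennpowr_def ennreal_eq_0_iff enn2real_eq_0_iff)
    have lt: "ennpowr (kernel_mean \<gamma> p f z) (1 / p) * ennpowr (kernel_mean \<gamma> q g z) (1 / q) < \<infinity>"
      using M(2)[OF z] by (rule le_less_trans) simp
    then have "ennpowr (kernel_mean \<gamma> p f z) (1 / p) \<noteq> \<infinity>" "ennpowr (kernel_mean \<gamma> q g z) (1 / q) \<noteq> \<infinity>"
      using pos by (auto simp: ennreal_mult_eq_top_iff ennreal_top_mult ennreal_mult_top)
    then have fin: "kernel_mean \<gamma> p f z \<noteq> \<infinity>" "kernel_mean \<gamma> q g z \<noteq> \<infinity>"
      by (auto simp: ennpowr_def)
    then show 1: "kernel_mean \<gamma> p f z = ennreal (\<omega> z)" "kernel_mean \<gamma> q g z = ennreal (v z)"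
      by (simp_all add: \<omega>_def v_def less_top)
    show "\<omega> z powr (1 / p) * v z powr (1 / q) \<le> M"
      using M(2)[OF z] M(1) fin by (simp add: ennpowr_def \<omega>_def v_def ennreal_mult[symmetric])
  qed
  \<comment> \<open>The summand 1 makes the constants positive even if \<open>M\<close> is 0;
    positive constants are required later as divisors.\<close>
  define D where "D = (M * C powr (1 / q)) powr p + 1"
  define E where "E = (M * C powr (1 / p)) powr q + 1"
  have D: "0 < D" and E: "0 < E" by (simp_all add: D_def E_def add_nonneg_pos)
  have Wf: "kernel_mean \<gamma> p f z
      \<le> ennreal (D * (cmod (f z) powr p * (1 - (cmod z)\<^sup>2) powr ((2 + \<gamma>) * (1 - p / 2))))" if z: "z \<in> \<bbbD>" for z
    using kernel_mean_le_of_product[OF C p q assms(3) g z fg(1)[OF z] M(1) means(1)[OF z] nn(1) means(2)[OF z] nn(2)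
        means(3)[OF z] diag[OF g z]]
    unfolding means(1)[OF z] D_def by (intro ennreal_leI) (simp add: distrib_right add_increasing2)
  \<comment> \<open>The same estimate with (f, p) and (g, q) exchanged.\<close>
  have Wg: "kernel_mean \<gamma> q g z
      \<le> ennreal (E * (cmod (g z) powr q * (1 - (cmod z)\<^sup>2) powr ((2 + \<gamma>) * (1 - q / 2))))" if z: "z \<in> \<bbbD>" for z
    using kernel_mean_le_of_product[OF C q p qp f z fg(2)[OF z] M(1) means(2)[OF z] nn(2) means(1)[OF z] nn(1)
        means(3)[OF z, unfolded mult.commute[of "\<omega> z powr _"]] diag[OF f z]]
    unfolding means(2)[OF z] E_def by (intro ennreal_leI) (simp add: distrib_right add_increasing2)
  have \<gamma>: "- 2 < \<gamma>" using assms(1) by simp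
  obtain \<epsilon>\<^sub>1 where \<epsilon>\<^sub>1: "0 < \<epsilon>\<^sub>1"
    and hf: "\<And>\<epsilon>. 0 < \<epsilon> \<Longrightarrow> \<epsilon> \<le> \<epsilon>\<^sub>1 \<Longrightarrow> \<exists>C\<ge>0. \<forall>a\<in>\<bbbD>.
      (\<integral>\<^sup>+u. ennreal (cmod (f u) powr (p + \<epsilon>) * cmod (bergman_kernel \<gamma> a u) powr (p + \<epsilon> * (1 - 2 / p))) \<partial>disk_measure \<gamma>)
        \<le> ennreal (C * \<omega> a powr ((p + \<epsilon>) / p))"
    using reverse_hoelder_kernel_mean[OF c \<gamma> p D f Wf] unfolding \<omega>_def by blast
  obtain \<epsilon>\<^sub>2 where \<epsilon>\<^sub>2: "0 < \<epsilon>\<^sub>2"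
    and hg: "\<And>\<epsilon>. 0 < \<epsilon> \<Longrightarrow> \<epsilon> \<le> \<epsilon>\<^sub>2 \<Longrightarrow> \<exists>C\<ge>0. \<forall>a\<in>\<bbbD>.
      (\<integral>\<^sup>+u. ennreal (cmod (g u) powr (q + \<epsilon>) * cmod (bergman_kernel \<gamma> a u) powr (q + \<epsilon> * (1 - 2 / q))) \<partial>disk_measure \<gamma>)
        \<le> ennreal (C * v a powr ((q + \<epsilon>) / q))"
    using reverse_hoelder_kernel_mean[OF c \<gamma> q E g Wg] unfolding v_def by blast
  define \<epsilon> where "\<epsilon> = min \<epsilon>\<^sub>1 \<epsilon>\<^sub>2"
  have \<epsilon>: "0 < \<epsilon>" "\<epsilon> \<le> \<epsilon>\<^sub>1" "\<epsilon> \<le> \<epsilon>\<^sub>2" using \<epsilon>\<^sub>1 \<epsilon>\<^sub>2 by (auto simp: \<epsilon>_def)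
  obtain A where A: "0 \<le> A" "\<And>a. a \<in> \<bbbD> \<Longrightarrow>
      (\<integral>\<^sup>+u. ennreal (cmod (f u) powr (p + \<epsilon>) * cmod (bergman_kernel \<gamma> a u) powr (p + \<epsilon> * (1 - 2 / p))) \<partial>disk_measure \<gamma>)
        \<le> ennreal (A * \<omega> a powr ((p + \<epsilon>) / p))"
    using hf[OF \<epsilon>(1,2)] by blast
  obtain B where B: "0 \<le> B" "\<And>a. a \<in> \<bbbD> \<Longrightarrow>
      (\<integral>\<^sup>+u. ennreal (cmod (g u) powr (q + \<epsilon>) * cmod (bergman_kernel \<gamma> a u) powr (q + \<epsilon> * (1 - 2 / q))) \<partial>disk_measure \<gamma>)
        \<le> ennreal (B * v a powr ((q + \<epsilon>) / q))"
    using hg[OF \<epsilon>(1,3)] by blast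
  define K where "K = A powr (1 / (p + \<epsilon>)) * B powr (1 / (q + \<epsilon>))"
  \<comment> \<open>Each higher mean is a constant times the corresponding original mean, so the
    product is bounded by \<open>K\<close> times the original one.\<close>
  have "(SUP z\<in>\<bbbD>. berezin_mean \<gamma> p (p + \<epsilon>) f z * berezin_mean \<gamma> q (q + \<epsilon>) g z) \<le> ennreal (K * M)"
  proof (rule SUP_least)
    fix z assume z: "z \<in> \<bbbD>"
    have "berezin_mean \<gamma> p (p + \<epsilon>) f z * berezin_mean \<gamma> q (q + \<epsilon>) g z
        \<le> ennreal (A powr (1 / (p + \<epsilon>)) * \<omega> z powr (1 / p)) * ennreal (B powr (1 / (q + \<epsilon>)) * v z powr (1 / q))"
      by (intro mult_mono berezin_mean_higher_le[OF z p \<epsilon>(1) A(1) nn(1) A(2)[OF z]]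
          berezin_mean_higher_le[OF z q \<epsilon>(1) B(1) nn(2) B(2)[OF z]]) auto
    also have "\<dots> = ennreal (K * (\<omega> z powr (1 / p) * v z powr (1 / q)))"
      by (simp add: ennreal_mult[symmetric] K_def mult_ac)
    also have "\<dots> \<le> ennreal (K * M)"
      using means(3)[OF z] by (intro ennreal_leI mult_left_mono) (auto simp: K_def)
    finally show "berezin_mean \<gamma> p (p + \<epsilon>) f z * berezin_mean \<gamma> q (q + \<epsilon>) g z \<le> ennreal (K * M)" .
  qed
  also have "\<dots> < \<infinity>" by simp
  finally show ?thesis
    using \<epsilon>(1) by (auto simp: g_def[abs_def])
qed

end
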